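(* Consider the distributed quantized algorithm (Inexact Semi-stochastic Gradient Descent) defined in the context, and let $x^{(s_t)}$, $\tilde x^{(s)}$ denote the concatenations over all nodes of $x_i^{(s_t)}$, $\tilde x_i^{(s)}$. This algorithm is equivalent to the Inexact Prox-SVRG method; that is, its iterates satisfy $\tilde x^{(0)}=0$, $x^{(s_0)}=\tilde x^{(s)}$, $\tilde x^{(s+1)}=\frac1T\sum_{t=1}^T x^{(s_t)}$ and, for $t=0,\dots,T-1$, with $\ell$ the random node chosen in inner iteration $s_t$, $$x^{(s_{t+1})}=\mathrm{prox}_{\eta R}\big(x^{(s_t)}-\eta v^{(s_t)}\big),$$ $$v^{(s_t)}=\mathcal{A}_\ell^{\mathsf T}\nabla f_\ell(x^{(s_t)}_{\mathcal{N}_\ell})-\mathcal{A}_\ell^{\mathsf T}\nabla f_\ell(\tilde x^{(s)}_{\mathcal{N}_\ell})+\frac1N\sum_{i=1}^N\mathcal{A}_i^{\mathsf T}\nabla f_i(\tilde x^{(s)}_{\mathcal{N}_i})+e^{(s_t)},$$ with $$\begin{aligned}e^{(s_t)}={}&\mathcal{A}_\ell^{\mathsf T}\big(\nabla f_\ell(\hat x^{(s_t)}_{\mathcal{N}_\ell})-\nabla f_\ell(x^{(s_t)}_{\mathcal{N}_\ell})\big)+\mathcal{A}_\ell^{\mathsf T}d_\ell^{(s_t)}-\mathcal{A}_\ell^{\mathsf T}\big(\nabla f_\ell(\hat{\tilde x}^{(s)}_{\mathcal{N}_\ell})-\nabla f_\ell(\tilde x^{(s)}_{\mathcal{N}_\ell})\big)-\mathcal{A}_\ell^{\mathsf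 T}b_\ell^{(s)}\\&+\frac1N\sum_{i=1}^N\mathcal{A}_i^{\mathsf T}\big(\nabla f_i(\hat{\tilde x}^{(s)}_{\mathcal{N}_i})-\nabla f_i(\tilde x^{(s)}_{\mathcal{N}_i})\big)+\frac1N\sum_{i=1}^N\mathcal{A}_i^{\mathsf T}b_i^{(s)}.\end{aligned}$$ Further, with $\overline L=\max_i L_i$, $$\mathbf{E}\|e^{(s_t)}\|^2\le 2\overline L^2\sum_{j\in\mathcal{N}_\ell}\mathbf{E}\|c_j^{(s_t)}\|^2+2\overline L^2\sum_{j\in\mathcal{N}_\ell}\mathbf{E}\|a_j^{(s)}\|^2+\mathbf{E}\|d_\ell^{(s_t)}\|^2+2\,\mathbf{E}\|b_\ell^{(s)}\|^2+\frac{2}{N^2}\sum_{i=1}^N\mathbf{E}\|b_i^{(s)}\|^2 .$$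
   Context: Setting. A connected undirected graph on nodes $1,\dots,N$; $\mathcal{N}_i$ is the set consisting of node $i$ and its neighbors. Node $i$ has a state $x_i\in\mathbb{R}^{m_i}$; $x=[x_1^{\mathsf T}\cdots x_N^{\mathsf T}]^{\mathsf T}\in\mathbb{R}^P$; $x_{\mathcal{N}_i}=\mathcal{A}_i x$ is the concatenation of the states of the nodes in $\mathcal{N}_i$ ($\mathcal{A}_i$ a selection matrix), and for $j\in\mathcal{N}_i$, $\mathcal{B}_{ij}$ is the selection matrix with $x_j=\mathcal{B}_{ij}x_{\mathcal{N}_i}$. The problem is to minimize $G(x)=F(x)+R(x)$ with $F(x)=\frac1N\sum_{i=1}^N f_i(x_{\mathcal{N}_i})$. $\|\cdot\|$ is the Euclidean norm and $\mathrm{prox}_{\eta R}(v)=\arg\min_y\frac12\|y-v\|^2+\eta R(y)$. Assumptions. Each $f_i$ is differentiable with $\nabla f_i$ Lipschitz with constant $L_i$. $R$ is lower semicontinuous and convex with closed effective domain $\mathrm{dom}(R)=\{x: R(x)<+\infty\}$. $G$ is strongly convex with parameter $\mu>0$: $G(x)-G(y)-\frac\mu2\|x-y\|^2\ge\xi^{\mathsf T}(x-y)$ for all $x,y\in\mathrm{dom}(R)$, $\xi\in\partial G(y)$. Each $\nabla f_i$ is linear or constant, meaning of the form $z\mapsto Hz+h$. The proximal operator acts blockwise: $\mathrm{prox}_{\eta R}(x)=[\mathrm{prox}_{\eta R}(x_1)^{\mathsf T}\cdots\mathrm{prox}_{\eta R}(x_N)^{\mathsf T}]^{\mathsf T}$,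 where block $i$ depends only on $x_i$. Quantizer. With $n$ bits, interval size $U>0$, midpoint $\bar z$ and $\Delta=\frac{U}{2^n-1}$, set $q(z)=\bar z+\mathrm{sgn}(z-\bar z)\,\Delta\,\lfloor |z-\bar z|/\Delta+\frac12\rfloor$ and $Q(z)=q(z+\nu)-\nu$, with dither $\nu$ uniform on $(-\Delta/2,\Delta/2)$, known to sender and receiver, drawn independently for each quantized scalar and independently of everything else. $Q$ is applied to vectors componentwise, with a vector midpoint and the same scalar $U$. The quantization interval is $[\bar z-U/2,\bar z+U/2]$; quantized values are taken to lie in their quantization intervals. Algorithm. Parameters: $T$, $\eta>0$, $\kappa\in(0,1)$, $C_a,C_b,C_c,C_d>0$. Initialize $\tilde x_i^{(0)}=0$, $\hat{\tilde x}_i^{(-1)}=0$, $\hat\nabla f_i^{(-1)}=0$. For $s=0,1,\dots$, every node $i$: 1. Forms $\hat{\tilde x}_i^{(s)}=Q_{a,i}^{(s)}(\tilde x_i^{(s)})=\tilde x_i^{(s)}+a_i^{(s)}$ (midpoint $\hat{\tilde x}_i^{(s-1)}$, interval size $C_a\kappa^{(s+1)/2}$) and sends it to its neighbors. 2. Computes $\nabla f_i^{(s)}=\nabla f_i(\hat{\tilde x}^{(s)}_{\mathcal{N}_i})$, forms $\hat\nabla f_i^{(s)}=Q_{b,i}^{(s)}(\nabla f_i^{(s)})=\nabla f_i^{(s)}+b_i^{(s)}$ (midpoint $\hat\nabla f_i^{(s-1)}$, interval size $C_b\kappa^{(s+1)/2}$) and sends it to its neighbors. 3. Computes $\tilde h_i^{(s)}=\frac1N\sum_{j\in\mathcal{N}_i}\mathcal{B}_{ji}\hat\nabla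 f_j^{(s)}$ and sets $x_i^{(s_0)}=\tilde x_i^{(s)}$. 4. For $t=0,\dots,T-1$: a node $\ell$ is drawn uniformly at random from $\{1,\dots,N\}$ (the same for all nodes). Each $i\in\mathcal{N}_\ell$ sends to $\ell$ the value $\hat x_i^{(s_t)}=Q_{c,i}^{(s_t)}(x_i^{(s_t)})=x_i^{(s_t)}+c_i^{(s_t)}$ (midpoint $\hat{\tilde x}_i^{(s)}$, interval size $C_c\kappa^{(s+1)/2}$). Node $\ell$ computes $\nabla f_\ell^{(s_t)}=\nabla f_\ell(\hat x^{(s_t)}_{\mathcal{N}_\ell})$ and sends its neighbors $\hat\nabla f_\ell^{(s_t)}=Q_{d,\ell}^{(s_t)}(\nabla f_\ell^{(s_t)})=\nabla f_\ell^{(s_t)}+d_\ell^{(s_t)}$ (midpoint $\hat\nabla f_\ell^{(s)}$, interval size $C_d\kappa^{(s+1)/2}$). If $i\in\mathcal{N}_\ell$, then $x_i^{(s_{t+1})}=\mathrm{prox}_{\eta R}\big(x_i^{(s_t)}-\eta(\mathcal{B}_{\ell i}\hat\nabla f_\ell^{(s_t)}-\mathcal{B}_{\ell i}\hat\nabla f_\ell^{(s)}+\tilde h_i^{(s)})\big)$; otherwise $x_i^{(s_{t+1})}=\mathrm{prox}_{\eta R}(x_i^{(s_t)}-\eta\tilde h_i^{(s)})$. 5. Sets $\tilde x_i^{(s+1)}=\frac1T\sum_{t=1}^T x_i^{(s_t)}$. $\mathbf{E}$ is expectation over the dithers and over the uniform random choice of $\ell$; in the displayed bound, expressions depending on $\ell$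 (including the index sets $\mathcal{N}_\ell$) are averaged over $\ell$. *)

theory Defs
  imports "HOL-Probability.Probability"
begin

text \<open>
  Nodes are the elements of a finite type \<open>'n\<close> (so \<open>N = CARD('n)\<close>), scalar coordinates of the
  global vector are the elements of a finite type \<open>'p\<close> (so \<open>P = CARD('p)\<close>), and each coordinate
  belongs to one node, its owner; \<open>m\<^sub>i\<close> is the number of coordinates owned by \<open>i\<close>.

  The spaces of the vectors \<open>x\<^sub>i\<close> and \<open>x\<^bsub>N\<^sub>i\<^esub>\<close> have different dimensions for different \<open>i\<close>. Each is
  represented by the coordinate subspace of \<open>real^'p\<close> spanned by the coordinates concerned, i.e.
  by vectors that are zero elsewhere. Norms, inner products and gradients agree with those of
  the corresponding Euclidean space. Concatenation of blocks becomes their sum.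
\<close>

type_synonym ('n, 'p) blocks = "'n \<Rightarrow> real^'p"

text \<open>
  Fields: \<open>loss\<close> is \<open>f\<^sub>i\<close>, \<open>gradl\<close> its gradient, \<open>lipc\<close> its Lipschitz constant \<open>L\<^sub>i\<close>, \<open>regul\<close> is
  \<open>R\<close>, \<open>smu\<close> is \<open>\<mu>\<close>, \<open>inner_len\<close> is \<open>T\<close>, \<open>stepsize\<close> is \<open>\<eta>\<close>, \<open>rate\<close> is \<open>\<kappa>\<close>. Only the values of
  \<open>loss i\<close> and \<open>gradl i\<close> on the coordinate subspace of the neighborhood of \<open>i\<close> matter.
\<close>

record ('n, 'p) isgd =
  edges :: "('n \<times> 'n) set"
  owner :: "'p \<Rightarrow> 'n"
  loss :: "'n \<Rightarrow> real^'p \<Rightarrow> real"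
  gradl :: "'n \<Rightarrow> real^'p \<Rightarrow> real^'p"
  lipc :: "'n \<Rightarrow> real"
  regul :: "real^'p \<Rightarrow> ereal"
  smu :: real
  nbits :: nat
  inner_len :: nat
  stepsize :: real
  rate :: real
  Ca :: real
  Cb :: real
  Cc :: real
  Cd :: real

definition nbh :: "('n::finite, 'p::finite) isgd \<Rightarrow> 'n \<Rightarrow> 'n set" where
  "nbh P i = insert i {j. (i, j) \<in> edges P}"

definition own_coords :: "('n::finite, 'p::finite) isgd \<Rightarrow> 'n \<Rightarrow> 'p set" where
  "own_coords P i = {k. owner P k = i}"

definition nbh_coords :: "('n::finite, 'p::finite) isgd \<Rightarrow> 'n \<Rightarrow> 'p set" where
  "nbh_coords P i = {k. owner P k \<in> nbh P i}"

definition coord_space :: "'p::finite set \<Rightarrow> (real^'p) set" where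
  "coord_space S = {z. \<forall>k. k \<notin> S \<longrightarrow> z $ k = 0}"

definition selmat :: "'p::finite set \<Rightarrow> real^'p^'p" where
  "selmat S = (\<chi> r c. if r = c \<and> r \<in> S then 1 else 0)"

definition Amat :: "('n::finite, 'p::finite) isgd \<Rightarrow> 'n \<Rightarrow> real^'p^'p" where
  "Amat P i = selmat (nbh_coords P i)"

text \<open>\<open>Bmat P i j\<close> extracts the block of \<open>j\<close> from a vector of neighborhood \<open>i\<close>; it is only
  used for \<open>j \<in> nbh P i\<close>.\<close>

definition Bmat :: "('n::finite, 'p::finite) isgd \<Rightarrow> 'n \<Rightarrow> 'n \<Rightarrow> real^'p^'p" where
  "Bmat P i j = selmat (own_coords P j \<inter> nbh_coords P i)"

definition conc :: "('n::finite, 'p::finite) blocks \<Rightarrow> real^'p" where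
  "conc y = (\<Sum>i\<in>UNIV. y i)"

definition smooth_part :: "('n::finite, 'p::finite) isgd \<Rightarrow> real^'p \<Rightarrow> real" where
  "smooth_part P x = (1 / real CARD('n)) * (\<Sum>i\<in>UNIV. loss P i (Amat P i *v x))"

definition objective :: "('n::finite, 'p::finite) isgd \<Rightarrow> real^'p \<Rightarrow> ereal" where
  "objective P x = ereal (smooth_part P x) + regul P x"

definition effdom :: "('a \<Rightarrow> ereal) \<Rightarrow> 'a set" where
  "effdom R = {x. R x < \<infinity>}"

definition lower_semicontinuous :: "('a::topological_space \<Rightarrow> ereal) \<Rightarrow> bool" where
  "lower_semicontinuous R \<longleftrightarrow> (\<forall>x. R x \<le> Liminf (at x) R)"

definition ereal_convex :: "('a::real_vector \<Rightarrow> ereal) \<Rightarrow> bool" where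
  "ereal_convex R \<longleftrightarrow> (\<forall>x y. \<forall>u\<in>{0..1}.
     R ((1 - u) *\<^sub>R x + u *\<^sub>R y) \<le> ereal (1 - u) * R x + ereal u * R y)"

definition subdifferential :: "('a::real_inner \<Rightarrow> ereal) \<Rightarrow> 'a \<Rightarrow> 'a set" where
  "subdifferential G y = {\<xi>. \<forall>x. G x \<ge> G y + ereal (\<xi> \<bullet> (x - y))}"

definition prox :: "real \<Rightarrow> ('a::real_normed_vector \<Rightarrow> ereal) \<Rightarrow> 'a \<Rightarrow> 'a" where
  "prox \<eta> R v = (ARG_MIN (\<lambda>y. ereal (1/2 * (norm (y - v))\<^sup>2) + ereal \<eta> * R y) y. True)"

definition gprox :: "('n::finite, 'p::finite) isgd \<Rightarrow> real^'p \<Rightarrow> real^'p" where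
  "gprox P = prox (stepsize P) (regul P)"

text \<open>The operator applied by node \<open>i\<close> alone, to a vector that is zero outside its own block.
  That it determines the full operator is the blockwise assumption in \<open>isgd_problem\<close>.\<close>

definition prox_block :: "('n::finite, 'p::finite) isgd \<Rightarrow> 'n \<Rightarrow> real^'p \<Rightarrow> real^'p" where
  "prox_block P i z = selmat (own_coords P i) *v gprox P z"

definition isgd_problem :: "('n::finite, 'p::finite) isgd \<Rightarrow> bool" where
  "isgd_problem P \<longleftrightarrow>
     sym (edges P) \<and> (\<forall>i j. (i, j) \<in> (edges P)\<^sup>*) \<and>
     (\<forall>i. \<forall>z \<in> coord_space (nbh_coords P i).
        gradl P i z \<in> coord_space (nbh_coords P i) \<and>
        (loss P i has_derivative (\<lambda>h. gradl P i z \<bullet> h))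
          (at z within coord_space (nbh_coords P i))) \<and>
     (\<forall>i. (lipc P i)-lipschitz_on (coord_space (nbh_coords P i)) (gradl P i)) \<and>
     (\<forall>i. \<exists>H h. \<forall>z \<in> coord_space (nbh_coords P i). gradl P i z = H *v z + h) \<and>
     (\<forall>x. regul P x \<noteq> -\<infinity>) \<and>
     lower_semicontinuous (regul P) \<and> ereal_convex (regul P) \<and> closed (effdom (regul P)) \<and>
     smu P > 0 \<and>
     (\<forall>x \<in> effdom (regul P). \<forall>y \<in> effdom (regul P). \<forall>\<xi> \<in> subdifferential (objective P) y.
        objective P x - objective P y - ereal (smu P / 2 * (norm (x - y))\<^sup>2)
          \<ge> ereal (\<xi> \<bullet> (x - y))) \<and>
     (\<forall>x. gprox P x = conc (\<lambda>i. prox_block P i (selmat (own_coords P i) *v x))) \<and>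
     nbits P > 0 \<and> inner_len P > 0 \<and> stepsize P > 0 \<and> 0 < rate P \<and> rate P < 1 \<and>
     Ca P > 0 \<and> Cb P > 0 \<and> Cc P > 0 \<and> Cd P > 0"

definition qdelta :: "nat \<Rightarrow> real \<Rightarrow> real" where
  "qdelta n U = U / (2 ^ n - 1)"

definition quant :: "nat \<Rightarrow> real \<Rightarrow> real \<Rightarrow> real \<Rightarrow> real" where
  "quant n U mid z =
     mid + sgn (z - mid) * qdelta n U * of_int \<lfloor>\<bar>z - mid\<bar> / qdelta n U + 1/2\<rfloor>"

definition dquant :: "nat \<Rightarrow> real \<Rightarrow> real \<Rightarrow> real \<Rightarrow> real \<Rightarrow> real" where
  "dquant n U mid \<nu> z = quant n U mid (z + \<nu>) - \<nu>"

definition vquant ::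
  "nat \<Rightarrow> real \<Rightarrow> 'p::finite set \<Rightarrow> real^'p \<Rightarrow> ('p \<Rightarrow> real) \<Rightarrow> real^'p \<Rightarrow> real^'p" where
  "vquant n U S mid \<nu> z = (\<chi> k. if k \<in> S then dquant n U (mid $ k) (\<nu> k) (z $ k) else 0)"

definition in_interval :: "real \<Rightarrow> 'p::finite set \<Rightarrow> real^'p \<Rightarrow> real^'p \<Rightarrow> bool" where
  "in_interval U S mid z \<longleftrightarrow> (\<forall>k\<in>S. z $ k \<in> {mid $ k - U/2 .. mid $ k + U/2})"

text \<open>One dither for every scalar that is ever quantized: \<open>DA s k\<close>, \<open>DB s i k\<close>, \<open>DC s t k\<close>,
  \<open>DD s t l k\<close> belong to coordinate \<open>k\<close> of the vectors \<open>xthat s (owner k)\<close>, \<open>ghat s i\<close>,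
  \<open>xinhat s t (owner k)\<close> and (when \<open>l\<close> is the node drawn) \<open>ginhat s t\<close> below.\<close>

datatype ('n, 'p) dither =
    DA nat 'p
  | DB nat 'n 'p
  | DC nat nat 'p
  | DD nat nat 'n 'p

definition qsize :: "('n::finite, 'p::finite) isgd \<Rightarrow> real \<Rightarrow> nat \<Rightarrow> real" where
  "qsize P C s = C * rate P powr ((real s + 1) / 2)"

fun dither_size :: "('n::finite, 'p::finite) isgd \<Rightarrow> ('n, 'p) dither \<Rightarrow> real" where
  "dither_size P (DA s k) = qsize P (Ca P) s"
| "dither_size P (DB s i k) = qsize P (Cb P) s"
| "dither_size P (DC s t k) = qsize P (Cc P) s"
| "dither_size P (DD s t l k) = qsize P (Cd P) s"

definition dithers :: "('n::finite, 'p::finite) isgd \<Rightarrow> ('n, 'p) dither set" where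
  "dithers P =
     {DA s k |s k. True} \<union>
     {DB s i k |s i k. k \<in> nbh_coords P i} \<union>
     {DC s t k |s t k. t < inner_len P} \<union>
     {DD s t l k |s t l k. t < inner_len P \<and> k \<in> nbh_coords P l}"

text \<open>The algorithm is a function of the realized dithers \<open>\<nu>\<close> and the realized node choices
  \<open>nd\<close>, where \<open>nd s t\<close> is the node drawn in inner iteration \<open>t\<close> of outer iteration \<open>s\<close>.\<close>

definition quantA ::
  "('n::finite, 'p::finite) isgd \<Rightarrow> (('n, 'p) dither \<Rightarrow> real) \<Rightarrow> nat \<Rightarrow>
   ('n, 'p) blocks \<Rightarrow> ('n, 'p) blocks \<Rightarrow> ('n, 'p) blocks" where
  "quantA P \<nu> s mid x = (\<lambda>i. vquant (nbits P) (qsize P (Ca P) s) (own_coords P i)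
     (mid i) (\<lambda>k. \<nu> (DA s k)) (x i))"

definition quantB ::
  "('n::finite, 'p::finite) isgd \<Rightarrow> (('n, 'p) dither \<Rightarrow> real) \<Rightarrow> nat \<Rightarrow>
   ('n, 'p) blocks \<Rightarrow> ('n, 'p) blocks \<Rightarrow> ('n, 'p) blocks" where
  "quantB P \<nu> s mid g = (\<lambda>i. vquant (nbits P) (qsize P (Cb P) s) (nbh_coords P i)
     (mid i) (\<lambda>k. \<nu> (DB s i k)) (g i))"

text \<open>Only nodes in the neighborhood of the drawn node send \<open>quantC\<close>; the value is defined for
  the other nodes too, but never used there.\<close>

definition quantC ::
  "('n::finite, 'p::finite) isgd \<Rightarrow> (('n, 'p) dither \<Rightarrow> real) \<Rightarrow> nat \<Rightarrow> nat \<Rightarrow>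
   ('n, 'p) blocks \<Rightarrow> ('n, 'p) blocks \<Rightarrow> ('n, 'p) blocks" where
  "quantC P \<nu> s t mid x = (\<lambda>i. vquant (nbits P) (qsize P (Cc P) s) (own_coords P i)
     (mid i) (\<lambda>k. \<nu> (DC s t k)) (x i))"

definition quantD ::
  "('n::finite, 'p::finite) isgd \<Rightarrow> (('n, 'p) dither \<Rightarrow> real) \<Rightarrow> nat \<Rightarrow> nat \<Rightarrow> 'n \<Rightarrow>
   real^'p \<Rightarrow> real^'p \<Rightarrow> real^'p" where
  "quantD P \<nu> s t l mid g = vquant (nbits P) (qsize P (Cd P) s) (nbh_coords P l)
     mid (\<lambda>k. \<nu> (DD s t l k)) g"

definition grads :: "('n::finite, 'p::finite) isgd \<Rightarrow> ('n, 'p) blocks \<Rightarrow> ('n, 'p) blocks" where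
  "grads P y = (\<lambda>i. gradl P i (Amat P i *v conc y))"

definition avg_grad :: "('n::finite, 'p::finite) isgd \<Rightarrow> ('n, 'p) blocks \<Rightarrow> ('n, 'p) blocks" where
  "avg_grad P gh = (\<lambda>i. (1 / real CARD('n)) *\<^sub>R (\<Sum>j\<in>nbh P i. Bmat P j i *v gh j))"

definition inner_step ::
  "('n::finite, 'p::finite) isgd \<Rightarrow> (('n, 'p) dither \<Rightarrow> real) \<Rightarrow> nat \<Rightarrow> nat \<Rightarrow> 'n \<Rightarrow>
   ('n, 'p) blocks \<Rightarrow> ('n, 'p) blocks \<Rightarrow> ('n, 'p) blocks \<Rightarrow> ('n, 'p) blocks" where
  "inner_step P \<nu> s t l xth gh x =
    (let \<eta> = stepsize P;
         h = avg_grad P gh;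
         g' = quantD P \<nu> s t l (gh l) (grads P (quantC P \<nu> s t xth x) l)
     in (\<lambda>i. if i \<in> nbh P l
             then prox_block P i
                    (x i - \<eta> *\<^sub>R (Bmat P l i *v g' - Bmat P l i *v gh l + h i))
             else prox_block P i (x i - \<eta> *\<^sub>R h i)))"

primrec inner_loop ::
  "('n::finite, 'p::finite) isgd \<Rightarrow> (('n, 'p) dither \<Rightarrow> real) \<Rightarrow> (nat \<Rightarrow> nat \<Rightarrow> 'n) \<Rightarrow> nat \<Rightarrow>
   ('n, 'p) blocks \<Rightarrow> ('n, 'p) blocks \<Rightarrow> ('n, 'p) blocks \<Rightarrow> nat \<Rightarrow> ('n, 'p) blocks" where
  "inner_loop P \<nu> nd s x0 xth gh 0 = x0"
| "inner_loop P \<nu> nd s x0 xth gh (Suc t) =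
     inner_step P \<nu> s t (nd s t) xth gh (inner_loop P \<nu> nd s x0 xth gh t)"

text \<open>The state at the start of outer iteration \<open>s\<close>: the current outer iterate, and the
  quantized iterates and quantized gradients of outer iteration \<open>s - 1\<close>.\<close>

primrec outer_state ::
  "('n::finite, 'p::finite) isgd \<Rightarrow> (('n, 'p) dither \<Rightarrow> real) \<Rightarrow> (nat \<Rightarrow> nat \<Rightarrow> 'n) \<Rightarrow> nat \<Rightarrow>
   ('n, 'p) blocks \<times> ('n, 'p) blocks \<times> ('n, 'p) blocks" where
  "outer_state P \<nu> nd 0 = (\<lambda>_. 0, \<lambda>_. 0, \<lambda>_. 0)"
| "outer_state P \<nu> nd (Suc s) =
    (let (xt, xprev, gprev) = outer_state P \<nu> nd s;
         xth = quantA P \<nu> s xprev xt;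
         gh = quantB P \<nu> s gprev (grads P xth)
     in (\<lambda>i. (1 / real (inner_len P)) *\<^sub>R
               (\<Sum>t = 1..inner_len P. inner_loop P \<nu> nd s xt xth gh t i),
         xth, gh))"

context
  fixes P :: "('n::finite, 'p::finite) isgd"
    and \<nu> :: "('n, 'p) dither \<Rightarrow> real"
    and nd :: "nat \<Rightarrow> nat \<Rightarrow> 'n"
begin

definition xtil :: "nat \<Rightarrow> ('n, 'p) blocks" where
  "xtil s = fst (outer_state P \<nu> nd s)"

definition xthat_prev :: "nat \<Rightarrow> ('n, 'p) blocks" where
  "xthat_prev s = fst (snd (outer_state P \<nu> nd s))"

definition ghat_prev :: "nat \<Rightarrow> ('n, 'p) blocks" where
  "ghat_prev s = snd (snd (outer_state P \<nu> nd s))"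

definition xthat :: "nat \<Rightarrow> ('n, 'p) blocks" where
  "xthat s = quantA P \<nu> s (xthat_prev s) (xtil s)"

definition ghat :: "nat \<Rightarrow> ('n, 'p) blocks" where
  "ghat s = quantB P \<nu> s (ghat_prev s) (grads P (xthat s))"

definition xin :: "nat \<Rightarrow> nat \<Rightarrow> ('n, 'p) blocks" where
  "xin s t = inner_loop P \<nu> nd s (xtil s) (xthat s) (ghat s) t"

definition xinhat :: "nat \<Rightarrow> nat \<Rightarrow> ('n, 'p) blocks" where
  "xinhat s t = quantC P \<nu> s t (xthat s) (xin s t)"

definition ginhat :: "nat \<Rightarrow> nat \<Rightarrow> real^'p" where
  "ginhat s t = quantD P \<nu> s t (nd s t) (ghat s (nd s t)) (grads P (xinhat s t) (nd s t))"

definition err_a :: "nat \<Rightarrow> ('n, 'p) blocks" where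
  "err_a s i = xthat s i - xtil s i"

definition err_b :: "nat \<Rightarrow> ('n, 'p) blocks" where
  "err_b s i = ghat s i - grads P (xthat s) i"

definition err_c :: "nat \<Rightarrow> nat \<Rightarrow> ('n, 'p) blocks" where
  "err_c s t i = xinhat s t i - xin s t i"

definition err_d :: "nat \<Rightarrow> nat \<Rightarrow> real^'p" where
  "err_d s t = ginhat s t - grads P (xinhat s t) (nd s t)"

definition svrg_err :: "nat \<Rightarrow> nat \<Rightarrow> real^'p" where
  "svrg_err s t =
    (let l = nd s t; A = Amat P; At = (\<lambda>i. transpose (Amat P i));
         x = conc (xin s t); xh = conc (xinhat s t);
         y = conc (xtil s); yh = conc (xthat s)
     in At l *v (gradl P l (A l *v xh) - gradl P l (A l *v x)) + At l *v err_d s t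
        - At l *v (gradl P l (A l *v yh) - gradl P l (A l *v y)) - At l *v err_b s l
        + (1 / real CARD('n)) *\<^sub>R
            (\<Sum>i\<in>UNIV. At i *v (gradl P i (A i *v yh) - gradl P i (A i *v y)))
        + (1 / real CARD('n)) *\<^sub>R (\<Sum>i\<in>UNIV. At i *v err_b s i))"

definition svrg_dir :: "nat \<Rightarrow> nat \<Rightarrow> real^'p" where
  "svrg_dir s t =
    (let l = nd s t; A = Amat P; At = (\<lambda>i. transpose (Amat P i));
         x = conc (xin s t); y = conc (xtil s)
     in At l *v gradl P l (A l *v x) - At l *v gradl P l (A l *v y)
        + (1 / real CARD('n)) *\<^sub>R (\<Sum>i\<in>UNIV. At i *v gradl P i (A i *v y))
        + svrg_err s t)"

definition values_in_intervals :: bool where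
  "values_in_intervals \<longleftrightarrow>
    (\<forall>s i. in_interval (qsize P (Ca P) s) (own_coords P i) (xthat_prev s i) (xtil s i)) \<and>
    (\<forall>s i. in_interval (qsize P (Cb P) s) (nbh_coords P i) (ghat_prev s i)
             (grads P (xthat s) i)) \<and>
    (\<forall>s. \<forall>t < inner_len P. \<forall>i \<in> nbh P (nd s t).
       in_interval (qsize P (Cc P) s) (own_coords P i) (xthat s i) (xin s t i)) \<and>
    (\<forall>s. \<forall>t < inner_len P.
       in_interval (qsize P (Cd P) s) (nbh_coords P (nd s t)) (ghat s (nd s t))
         (grads P (xinhat s t) (nd s t)))"

end

text \<open>The events generated by one elementary random variable: \<open>Inl (s, t)\<close> stands for the
  choice \<open>nd s t\<close> and \<open>Inr \<delta>\<close> for the dither \<open>\<nu> \<delta>\<close>. (\<open>indep_vars\<close> requires all variables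
  to have the same value type, hence \<open>indep_sets\<close> below.)\<close>

fun source_events ::
  "'w measure \<Rightarrow> ('w \<Rightarrow> ('n, 'p) dither \<Rightarrow> real) \<Rightarrow> ('w \<Rightarrow> nat \<Rightarrow> nat \<Rightarrow> 'n) \<Rightarrow>
   (nat \<times> nat) + ('n, 'p) dither \<Rightarrow> 'w set set" where
  "source_events M \<nu> nd (Inl st) = {(\<lambda>\<omega>. nd \<omega> (fst st) (snd st)) -` A \<inter> space M |A. True}"
| "source_events M \<nu> nd (Inr \<delta>) = {(\<lambda>\<omega>. \<nu> \<omega> \<delta>) -` A \<inter> space M |A. A \<in> sets borel}"

definition isgd_randomness ::
  "('n::finite, 'p::finite) isgd \<Rightarrow> 'w measure \<Rightarrow> ('w \<Rightarrow> ('n, 'p) dither \<Rightarrow> real) \<Rightarrow>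
   ('w \<Rightarrow> nat \<Rightarrow> nat \<Rightarrow> 'n) \<Rightarrow> bool" where
  "isgd_randomness P M \<nu> nd \<longleftrightarrow>
     prob_space M \<and>
     (\<forall>s. \<forall>t < inner_len P.
        (\<lambda>\<omega>. nd \<omega> s t) \<in> measurable M (count_space UNIV) \<and>
        distr M (count_space UNIV) (\<lambda>\<omega>. nd \<omega> s t) = uniform_count_measure UNIV) \<and>
     (\<forall>\<delta> \<in> dithers P.
        (\<lambda>\<omega>. \<nu> \<omega> \<delta>) \<in> borel_measurable M \<and>
        distr M borel (\<lambda>\<omega>. \<nu> \<omega> \<delta>) = uniform_measure lborel
          {- qdelta (nbits P) (dither_size P \<delta>) / 2 <..< qdelta (nbits P) (dither_size P \<delta>) / 2}) \<and>
     prob_space.indep_sets M (source_events M \<nu> nd)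
       (Inl ` {(s, t). t < inner_len P} \<union> Inr ` dithers P)"

end

theory Submission
  imports Defs
begin

text \<open>
  The recursion is a coordinatewise identity, since the blocks written by the nodes have
  disjoint supports and the proximal operator acts blockwise.

  For the bound, write the error as \<open>C - (A\<^sub>l - avg A) - (B\<^sub>l - avg B) + D\<close>, where \<open>C\<close> and \<open>A\<^sub>i\<close> are
  linear images of the errors \<open>c\<close> and \<open>a\<close> (the gradients are affine), \<open>B\<^sub>i = b\<^sub>i\<close> and \<open>D = d\<close>. Under a
  uniform dither the quantization error has mean zero for every fixed input, and each dither is
  independent of all earlier quantities. Hence \<open>D\<close> is orthogonal to all other terms and \<open>C\<close> is
  orthogonal to the \<open>A\<close> and \<open>B\<close> terms. The drawn node \<open>l\<close> is independent of the families \<open>A\<close> and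
  \<open>B\<close>, so subtracting their averages can only decrease the second moments; Lipschitz continuity
  bounds \<open>C\<close> and \<open>A\<^sub>l\<close> by the errors \<open>c\<close> and \<open>a\<close> over the neighborhood of \<open>l\<close>. Independence arguments
  need the iterates to be measurable, hence the proximal operator: it is nonexpansive on the
  closed set of points where a minimizer exists and constant elsewhere.
\<close>

section \<open>Measurability of the proximal operator\<close>

text \<open>The proof has no bound on the iterates, so it never takes moments of them. What it
  bounds is each quantization error, by half a grid step per coordinate. The gradients being affine,
  every gradient difference is a linear image of such errors and hence bounded as well, which makes
  integrability and Fubini automatic. Linearity also preserves mean zero: under a merely Lipschitz
  gradient a centered perturbation need not give a centered difference, and the cross terms would
  survive.

  Independence is used one source at a time. For each source the sigma-algebra generated by all the
  others is formed, and that single source is integrated out with everything else frozen. Inner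
  products are therefore expanded into coordinates, one dither each.

  The factor 2 on the \<open>a\<close> and \<open>b\<close> terms is the price of separating a sum
  of two vectors without orthogonality; the \<open>c\<close> and \<open>d\<close> terms are split
  off exactly. For the proximal operator the existence of minimizers is sidestepped: only the set of
  points that have one must be closed.\<close>

lemma lower_semicontinuousD:
  fixes R :: "'a::topological_space \<Rightarrow> ereal"
  assumes "lower_semicontinuous R" "C < R y"
  shows "eventually (\<lambda>x. C < R x) (nhds y)"
proof -
  have "R y \<le> Liminf (at y) R"
    using assms(1) by (simp add: lower_semicontinuous_def)
  then have "eventually (\<lambda>x. C < R x) (at y)"
    using assms(2) by (simp add: le_Liminf_iff)
  \<comment> \<open>The \<open>Liminf\<close> ignores the point \<open>y\<close> itself; there the
    bound is the assumption.\<close>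
  then show ?thesis
    using assms(2) by (auto simp: eventually_at_filter elim: eventually_mono)
qed

definition prox_objective :: "real \<Rightarrow> ('a::real_normed_vector \<Rightarrow> ereal) \<Rightarrow> 'a \<Rightarrow> 'a \<Rightarrow> ereal" where
  "prox_objective \<eta> R v y = ereal (1/2 * (norm (y - v))\<^sup>2) + ereal \<eta> * R y"

text \<open>A relation rather than a function: \<open>prox\<close> chooses by \<open>SOME\<close>,
  which carries no information at a point without a minimizer.\<close>

definition prox_minimizer :: "real \<Rightarrow> ('a::real_normed_vector \<Rightarrow> ereal) \<Rightarrow> 'a \<Rightarrow> 'a \<Rightarrow> bool" where
  "prox_minimizer \<eta> R v y \<longleftrightarrow> (\<forall>z. prox_objective \<eta> R v y \<le> prox_objective \<eta> R v z)"

lemma prox_eq: "prox \<eta> R v = (SOME y. prox_minimizer \<eta> R v y)"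
  by (simp add: prox_def arg_min_def is_arg_min_linorder prox_minimizer_def prox_objective_def)

context
  fixes R :: "'a::euclidean_space \<Rightarrow> ereal" and \<eta> :: real and y0 :: 'a
  assumes ninf: "\<And>x. R x \<noteq> -\<infinity>"
    and lsc: "lower_semicontinuous R"
    and conv: "ereal_convex R"
    and \<eta>: "\<eta> > 0"
    and y0: "R y0 < \<infinity>"
begin

lemma prox_minimizer_finite:
  assumes "prox_minimizer \<eta> R v y"
  shows "R y < \<infinity>"
proof (rule ccontr)
  assume "\<not> R y < \<infinity>"
  then have "prox_objective \<eta> R v y = \<infinity>"
    using \<eta> by (simp add: prox_objective_def)
  moreover have "prox_objective \<eta> R v y \<le> prox_objective \<eta> R v y0"
    using assms by (simp add: prox_minimizer_def)
  moreover have "prox_objective \<eta> R v y0 < \<infinity>"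
    using y0 ninf[of y0] \<eta> by (cases "R y0") (auto simp: prox_objective_def)
  ultimately show False by simp
qed

text \<open>First-order optimality without subgradients: compare \<open>y\<close> with a point of
  the segment towards \<open>z\<close>, use convexity of \<open>R\<close>, and divide by the segment
  parameter \<open>u\<close>. The quadratic remainder \<open>u * c\<close> vanishes as
  \<open>u\<close> tends to 0 from the right.\<close>

lemma prox_variational_inequality:
  assumes y: "prox_minimizer \<eta> R v y" and z: "R z < \<infinity>"
  shows "(v - y) \<bullet> (z - y) \<le> \<eta> * (real_of_ereal (R z) - real_of_ereal (R y))"
proof -
  obtain ry where ry: "R y = ereal ry"
    using prox_minimizer_finite[OF y] ninf[of y] by (cases "R y") auto
  obtain rz where rz: "R z = ereal rz"
    using z ninf[of z] by (cases "R z") auto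
  define c where "c = (norm (z - y))\<^sup>2 / 2"
  have key: "(v - y) \<bullet> (z - y) \<le> \<eta> * (rz - ry) + u * c" if u: "0 < u" "u < 1" for u
  proof -
    define w where "w = (1 - u) *\<^sub>R y + u *\<^sub>R z"
    have "R w \<le> ereal ((1 - u) * ry + u * rz)"
      using conv u unfolding ereal_convex_def w_def
      by (metis atLeastAtMost_iff less_imp_le plus_ereal.simps(1) ry rz times_ereal.simps(1))
    moreover obtain rw where rw: "R w = ereal rw"
      using calculation ninf[of w] by (cases "R w") auto
    ultimately have rwle: "rw \<le> (1 - u) * ry + u * rz" by simp
    have "prox_objective \<eta> R v y \<le> prox_objective \<eta> R v w"
      using y by (simp add: prox_minimizer_def)
    then have le: "1/2 * (norm (y - v))\<^sup>2 + \<eta> * ry \<le> 1/2 * (norm (w - v))\<^sup>2 + \<eta> * rw"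
      by (simp add: prox_objective_def ry rw)
    have "w - v = (y - v) + u *\<^sub>R (z - y)"
      by (simp add: w_def algebra_simps)
    have "(norm (w - v))\<^sup>2 = (norm (y - v))\<^sup>2 + 2 * u * ((y - v) \<bullet> (z - y)) + u\<^sup>2 * (norm (z - y))\<^sup>2"
      unfolding \<open>w - v = _\<close> power2_norm_eq_inner
      by (simp add: inner_add_left inner_add_right inner_commute power2_eq_square)
    moreover have "\<eta> * rw \<le> \<eta> * ((1 - u) * ry + u * rz)"
      using rwle \<eta> by simp
    ultimately have "0 \<le> u * ((y - v) \<bullet> (z - y)) + u\<^sup>2 * c + \<eta> * u * (rz - ry)"
      using le by (simp add: c_def algebra_simps)
    also have "\<dots> = u * ((y - v) \<bullet> (z - y) + u * c + \<eta> * (rz - ry))"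
      by (simp add: power2_eq_square algebra_simps)
    finally have "0 \<le> (y - v) \<bullet> (z - y) + u * c + \<eta> * (rz - ry)"
      using u by (simp add: zero_le_mult_iff)
    moreover have "(y - v) \<bullet> (z - y) = - ((v - y) \<bullet> (z - y))"
      by (simp add: inner_diff_left)
    ultimately show ?thesis by simp
  qed
  have "((\<lambda>u. \<eta> * (rz - ry) + u * c) \<longlongrightarrow> \<eta> * (rz - ry) + 0 * c) (at_right 0)"
    by (intro tendsto_intros)
  moreover have "eventually (\<lambda>u. (v - y) \<bullet> (z - y) \<le> \<eta> * (rz - ry) + u * c) (at_right 0)"
    using eventually_at_right_less[of 0] eventually_at_right_real[of 0 "1::real"]
    by (auto elim!: eventually_mono intro: key)
  ultimately have "(v - y) \<bullet> (z - y) \<le> \<eta> * (rz - ry) + 0 * c"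
    by (intro tendsto_lowerbound) auto
  then show ?thesis by (simp add: ry rz)
qed

text \<open>Each variational inequality is tested with the minimizer of the other. In the sum the
  values of \<open>R\<close> cancel, and Cauchy-Schwarz finishes.\<close>

lemma prox_minimizer_nonexpansive:
  assumes "prox_minimizer \<eta> R v y" "prox_minimizer \<eta> R v' y'"
  shows "norm (y - y') \<le> norm (v - v')"
proof -
  have "(v - y) \<bullet> (y' - y) + (v' - y') \<bullet> (y - y') \<le> 0"
    using prox_variational_inequality[OF assms(1) prox_minimizer_finite[OF assms(2)]]
      prox_variational_inequality[OF assms(2) prox_minimizer_finite[OF assms(1)]]
    by (simp add: algebra_simps)
  then have "(norm (y - y'))\<^sup>2 \<le> (v - v') \<bullet> (y - y')"
    by (simp add: power2_norm_eq_inner algebra_simps inner_commute)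
  also have "\<dots> \<le> norm (v - v') * norm (y - y')"
    by (rule norm_cauchy_schwarz)
  finally show ?thesis
    by (cases "y = y'") (auto simp: power2_eq_square)
qed

text \<open>Nonexpansiveness for equal inputs is uniqueness, so the choice made by
  \<open>SOME\<close> is forced.\<close>

lemma prox_eqI:
  assumes "prox_minimizer \<eta> R v y"
  shows "prox \<eta> R v = y"
proof -
  have "prox_minimizer \<eta> R v (prox \<eta> R v)"
    unfolding prox_eq using assms by (rule someI)
  from prox_minimizer_nonexpansive[OF this assms] show ?thesis by simp
qed

text \<open>The graph of the minimizer relation is closed: the optimality inequality passes to the
  limit, with lower semicontinuity controlling \<open>R (ys n)\<close> from below.\<close>

lemma prox_minimizer_limit:
  assumes M: "\<And>n. prox_minimizer \<eta> R (vs n) (ys n)"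
    and v: "vs \<longlonglongrightarrow> v" and y: "ys \<longlonglongrightarrow> y"
  shows "prox_minimizer \<eta> R v y"
  unfolding prox_minimizer_def
proof (rule allI, rule ccontr)
  fix z
  assume "\<not> prox_objective \<eta> R v y \<le> prox_objective \<eta> R v z"
  then have lt: "prox_objective \<eta> R v z < prox_objective \<eta> R v y" by simp
  obtain rz where rz: "R z = ereal rz"
    using lt ninf[of z] \<eta> by (cases "R z") (auto simp: prox_objective_def)
  \<comment> \<open>The value that \<open>R y\<close> would need for \<open>y\<close> and
    \<open>z\<close> to have equal objective.\<close>
  define b where "b = ((norm (z - v))\<^sup>2 / 2 - (norm (y - v))\<^sup>2 / 2) / \<eta> + rz"
  have eta_b: "\<eta> * b = (norm (z - v))\<^sup>2 / 2 - (norm (y - v))\<^sup>2 / 2 + \<eta> * rz"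
    using \<eta> by (simp add: b_def distrib_left)
  have "ereal b < R y"
  proof (cases "R y")
    case (real r)
    have "(norm (z - v))\<^sup>2 / 2 + \<eta> * rz < (norm (y - v))\<^sup>2 / 2 + \<eta> * r"
      using lt by (simp add: prox_objective_def rz real)
    then have "\<eta> * b < \<eta> * r" by (simp add: eta_b)
    then show ?thesis using \<eta> real by simp
  qed (use ninf in auto)
  \<comment> \<open>A real number strictly in between treats finite and infinite \<open>R y\<close>
    alike, and it stays below \<open>R (ys n)\<close> for large \<open>n\<close>.\<close>
  then obtain C where C: "ereal b < ereal C" "ereal C < R y"
    using ereal_dense2[of "ereal b" "R y"] by blast
  have ev: "eventually (\<lambda>n. ereal C < R (ys n)) sequentially"
    using filterlim_iff[THEN iffD1, OF y] lower_semicontinuousD[OF lsc C(2)] by blast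
  have "eventually (\<lambda>n. (norm (ys n - vs n))\<^sup>2 / 2 + \<eta> * C \<le> (norm (z - vs n))\<^sup>2 / 2 + \<eta> * rz) sequentially"
    using ev
  proof (rule eventually_mono)
    fix n
    assume gt: "ereal C < R (ys n)"
    obtain r where r: "R (ys n) = ereal r"
      using prox_minimizer_finite[OF M] ninf by (cases "R (ys n)") auto
    have "prox_objective \<eta> R (vs n) (ys n) \<le> prox_objective \<eta> R (vs n) z"
      using M by (simp add: prox_minimizer_def)
    then have "(norm (ys n - vs n))\<^sup>2 / 2 + \<eta> * r \<le> (norm (z - vs n))\<^sup>2 / 2 + \<eta> * rz"
      by (simp add: prox_objective_def r rz)
    moreover have "\<eta> * C \<le> \<eta> * r" using gt r \<eta> by simp
    ultimately show "(norm (ys n - vs n))\<^sup>2 / 2 + \<eta> * C \<le> (norm (z - vs n))\<^sup>2 / 2 + \<eta> * rz"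
      by linarith
  qed
  moreover have "(\<lambda>n. (norm (ys n - vs n))\<^sup>2 / 2 + \<eta> * C) \<longlonglongrightarrow> (norm (y - v))\<^sup>2 / 2 + \<eta> * C"
    "(\<lambda>n. (norm (z - vs n))\<^sup>2 / 2 + \<eta> * rz) \<longlonglongrightarrow> (norm (z - v))\<^sup>2 / 2 + \<eta> * rz"
    by (intro tendsto_intros v y; simp)+
  ultimately have "(norm (y - v))\<^sup>2 / 2 + \<eta> * C \<le> (norm (z - v))\<^sup>2 / 2 + \<eta> * rz"
    by (intro tendsto_le[OF sequentially_bot]) auto
  then have "\<eta> * C \<le> \<eta> * b" by (simp add: eta_b)
  then show False using C(1) \<eta> by simp
qed

text \<open>Nonexpansiveness makes the minimizers of a convergent sequence of inputs a Cauchy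
  sequence, so completeness takes the place of coercivity and compactness.\<close>

lemma closed_prox_minimizer_exists: "closed {v. \<exists>y. prox_minimizer \<eta> R v y}"
proof (subst closed_sequential_limits, safe)
  fix vs v
  assume "\<forall>n. vs n \<in> {v. \<exists>y. prox_minimizer \<eta> R v y}" and v: "vs \<longlonglongrightarrow> v"
  then obtain ys where M: "\<And>n. prox_minimizer \<eta> R (vs n) (ys n)"
    by (simp, metis)
  have "Cauchy ys"
  proof (rule CauchyI)
    fix e :: real
    assume "e > 0"
    then obtain N where "\<And>m n. m \<ge> N \<Longrightarrow> n \<ge> N \<Longrightarrow> norm (vs m - vs n) < e"
      using CauchyD[OF LIMSEQ_imp_Cauchy[OF v]] by blast
    then show "\<exists>N. \<forall>m\<ge>N. \<forall>n\<ge>N. norm (ys m - ys n) < e"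
      using prox_minimizer_nonexpansive[OF M M] by (meson le_less_trans)
  qed
  then obtain y where "ys \<longlonglongrightarrow> y"
    using Cauchy_convergent convergent_def by blast
  from prox_minimizer_limit[OF M v this] show "\<exists>y. prox_minimizer \<eta> R v y" by blast
qed

lemma borel_measurable_prox_proper: "prox \<eta> R \<in> borel_measurable borel"
proof -
  let ?D = "{v. \<exists>y. prox_minimizer \<eta> R v y}"
  have D: "?D \<in> sets borel"
    using closed_prox_minimizer_exists by (rule borel_closed)
  have "1-lipschitz_on ?D (prox \<eta> R)"
  proof (rule lipschitz_onI)
    fix v v'
    assume "v \<in> ?D" "v' \<in> ?D"
    then obtain y y' where "prox_minimizer \<eta> R v y" "prox_minimizer \<eta> R v' y'" by auto
    then show "dist (prox \<eta> R v) (prox \<eta> R v') \<le> 1 * dist v v'"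
      using prox_minimizer_nonexpansive by (simp add: prox_eqI dist_norm)
  qed simp
  then have cont: "continuous_on ?D (prox \<eta> R)"
    by (rule lipschitz_on_continuous_on)
  \<comment> \<open>Where no minimizer exists the predicate under \<open>SOME\<close> is identically
    \<open>False\<close>, so the chosen value is the same at all such points.\<close>
  have "prox \<eta> R = (\<lambda>v. if v \<in> ?D then prox \<eta> R v else (SOME y. False))"
    by (auto simp: fun_eq_iff prox_eq)
  moreover have "(\<lambda>v. if v \<in> ?D then prox \<eta> R v else (SOME y. False)) \<in> borel_measurable borel"
    using D cont by (intro borel_measurable_continuous_on_if) auto
  ultimately show ?thesis by simp
qed

end

lemma borel_measurable_prox:
  fixes R :: "'a::euclidean_space \<Rightarrow> ereal"
  assumes "\<And>x. R x \<noteq> -\<infinity>" "lower_semicontinuous R" "ereal_convex R" "\<eta> > 0"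
  shows "prox \<eta> R \<in> borel_measurable borel"
proof (cases "\<exists>y. R y < \<infinity>")
  case True
  then show ?thesis using borel_measurable_prox_proper[OF assms] by blast
next
  case False
  \<comment> \<open>With an empty domain every point is a minimizer, and \<open>prox\<close> is
    constant.\<close>
  then have "R = (\<lambda>_. \<infinity>)" by auto
  then have "prox \<eta> R = (\<lambda>v. SOME y. True)"
    using assms(4) by (simp add: fun_eq_iff prox_eq prox_minimizer_def prox_objective_def)
  then show ?thesis by simp
qed

section \<open>Dithered quantization and freezing\<close>

text \<open>Rounding to the nearest multiple of \<open>d\<close>, ties away from zero: the quantizer
  with its midpoint moved to the origin.\<close>

definition grid_round :: "real \<Rightarrow> real \<Rightarrow> real" where
  "grid_round d y = sgn y * d * of_int \<lfloor>\<bar>y\<bar> / d + 1/2\<rfloor>"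

lemma dquant_eq: "dquant n U m v z = m + grid_round (qdelta n U) (z + v - m) - v"
  by (simp add: dquant_def quant_def grid_round_def)

lemma grid_round_error:
  assumes "d > 0"
  shows "\<bar>grid_round d y - y\<bar> \<le> d / 2"
proof -
  define k where "k = \<lfloor>\<bar>y\<bar> / d + 1/2\<rfloor>"
  have "of_int k \<le> \<bar>y\<bar> / d + 1/2" "\<bar>y\<bar> / d + 1/2 < of_int k + 1"
    unfolding k_def by linarith+
  then have 1: "d * of_int k \<le> \<bar>y\<bar> + d/2" "\<bar>y\<bar> < d * of_int k + d/2"
    using assms by (simp_all add: field_simps)
  have 2: "grid_round d y = sgn y * d * of_int k"
    by (simp add: grid_round_def k_def)
  show ?thesis
  proof (cases y "0::real" rule: linorder_cases)
    case equal
    then show ?thesis using assms by (simp add: grid_round_def)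
  qed (use 1 2 in \<open>auto simp: abs_real_def\<close>)
qed

text \<open>The strict inequality excludes ties, so the sign convention in \<open>grid_round\<close>
  cannot matter; at \<open>y = 0\<close> it forces \<open>k = 0\<close>.\<close>

lemma grid_round_eqI:
  assumes "d > 0" "\<bar>y - of_int k * d\<bar> < d / 2"
  shows "grid_round d y = of_int k * d"
proof -
  have k: "of_int k * d - d/2 < y" "y < of_int k * d + d/2"
    using assms(2) by (auto simp: abs_if split: if_splits)
  then have kd: "of_int k - 1/2 < y/d" "y/d < of_int k + 1/2"
    using assms(1) by (auto simp: field_simps)
  show ?thesis
  proof (cases y "0::real" rule: linorder_cases)
    case less
    have "\<lfloor>- y / d + 1/2\<rfloor> = - k"
      using kd by (intro floor_unique) auto
    then show ?thesis using less by (simp add: grid_round_def)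
  next
    case equal
    with kd have "of_int k < (1::real)" "of_int k > (-1::real)" by simp_all
    then have "k = 0" by linarith
    then show ?thesis using equal by (simp add: grid_round_def)
  next
    case greater
    have "\<lfloor>y / d + 1/2\<rfloor> = k"
      using kd by (intro floor_unique) auto
    then show ?thesis using greater by (simp add: grid_round_def)
  qed
qed

lemma uniform_measure_symmetric_interval:
  fixes d :: real
  assumes "d > 0"
  shows "uniform_measure lborel {- d / 2 <..< d / 2} =
    density lborel (\<lambda>x. ennreal (indicator {- d / 2 <..< d / 2} x / d))"
  unfolding uniform_measure_def using assms
  by (intro arg_cong[where f = "density lborel"])
    (auto simp: fun_eq_iff divide_ennreal ennreal_1[symmetric] simp del: ennreal_1 split: split_indicator)

text \<open>The integrand is odd: the substitution of \<open>-x\<close> for \<open>x\<close> shows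
  that the integral equals its own negative.\<close>

lemma integral_uniform_measure_symmetric:
  fixes d :: real
  assumes "d > 0"
  shows "(\<integral>v. v \<partial>uniform_measure lborel {- d / 2 <..< d / 2}) = 0"
proof -
  let ?f = "\<lambda>x::real. indicator {- d / 2 <..< d / 2} x / d * x"
  have "(\<integral>v. v \<partial>uniform_measure lborel {- d / 2 <..< d / 2}) = (\<integral>x. ?f x \<partial>lborel)"
    unfolding uniform_measure_symmetric_interval[OF assms] using assms
    by (subst integral_density) auto
  moreover have "(\<integral>x. ?f x \<partial>lborel) = (\<integral>x. ?f (- x) \<partial>lborel)"
    using lborel_integral_real_affine[of "-1" ?f 0] by simp
  moreover have "(\<integral>x. ?f (- x) \<partial>lborel) = (\<integral>x. - ?f x \<partial>lborel)"
    by (intro Bochner_Integration.integral_cong) (auto split: split_indicator)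
  ultimately show ?thesis by simp
qed

lemma borel_measurable_grid_round [measurable]: "grid_round d \<in> borel_measurable borel"
  unfolding grid_round_def[abs_def] by measurable

text \<open>A window of length \<open>d\<close> contains exactly one rounding threshold, so under a uniform dither
  the rounded value takes two adjacent grid values with probabilities that average to the input.\<close>

lemma integral_grid_round_error:
  fixes d :: real
  assumes d: "d > 0"
  shows "(\<integral>v. grid_round d (y + v) - (y + v) \<partial>uniform_measure lborel {- d / 2 <..< d / 2}) = 0"
proof -
  define U where "U = uniform_measure lborel {- d / 2 <..< d / 2}"
  have [measurable_cong]: "sets U = sets borel" by (simp add: U_def)
  interpret U: prob_space U
    unfolding U_def using d by (intro prob_space_uniform_measure) auto
  \<comment> \<open>The grid point \<open>n * d\<close> is the last one not above \<open>y\<close>,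
    and \<open>c\<close> is the dither that puts \<open>y + c\<close> on the tie between it and the
    next.\<close>
  define n where "n = \<lfloor>y / d\<rfloor>"
  define c where "c = (of_int n + 1/2) * d - y"
  have "of_int n \<le> y / d" "y / d < of_int n + 1"
    unfolding n_def by linarith+
  then have y: "of_int n * d \<le> y" "y < (of_int n + 1) * d"
    using d by (simp_all add: field_simps)
  have "AE v in U. grid_round d (y + v) = of_int n * d + d * indicator {c<..} v"
  unfolding U_def
  proof (rule AE_uniform_measureI)
    \<comment> \<open>The tie \<open>v = c\<close> is a null set, so its rounding direction is
      irrelevant.\<close>
    show "AE v in lborel. v \<in> {- d / 2 <..< d / 2} \<longrightarrow>
      grid_round d (y + v) = of_int n * d + d * indicator {c<..} v"
      using AE_lborel_singleton[of c]
    proof eventually_elim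
      case (elim v)
      show ?case
      proof
        assume v: "v \<in> {- d / 2 <..< d / 2}"
        show "grid_round d (y + v) = of_int n * d + d * indicator {c<..} v"
        proof (cases "v > c")
          case True
          have "grid_round d (y + v) = of_int (n + 1) * d"
            using True v y by (intro grid_round_eqI d) (auto simp: c_def abs_if algebra_simps)
          then show ?thesis using True by (simp add: algebra_simps)
        next
          case False
          then have "v < c" using elim by simp
          have "grid_round d (y + v) = of_int n * d"
            using \<open>v < c\<close> v y by (intro grid_round_eqI d) (auto simp: c_def abs_if algebra_simps)
          then show ?thesis using False by simp
        qed
      qed
    qed
  qed auto
  then have "(\<integral>v. grid_round d (y + v) - (y + v) \<partial>U) =
      (\<integral>v. (of_int n * d + d * indicator {c<..} v) - (y + v) \<partial>U)"
  proof (intro integral_cong_AE)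
    show "(\<lambda>v. grid_round d (y + v) - (y + v)) \<in> borel_measurable U" by measurable
    show "(\<lambda>v. of_int n * d + d * indicator {c<..} v - (y + v)) \<in> borel_measurable U" by measurable
  qed auto
  also have "\<dots> = of_int n * d + d * measure U {c<..} - y - (\<integral>v. v \<partial>U)"
  proof -
    have v: "integrable U (\<lambda>v. v)"
    proof (rule U.integrable_const_bound)
      show "AE v in U. norm v \<le> d"
        unfolding U_def by (rule AE_uniform_measureI) (use d in auto)
    qed simp
    have "integrable U (\<lambda>v. indicator {c<..} v :: real)"
      by (rule U.integrable_const_bound[where B = 1]) (auto split: split_indicator)
    moreover have "(\<integral>v. indicator {c<..} v \<partial>U) = measure U {c<..}"
      by (simp add: U_def)
    ultimately show ?thesis using v by (simp add: U.prob_space)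
  qed
  \<comment> \<open>The part of the window above \<open>c\<close> has length \<open>d/2 - c\<close>,
    which is exactly the distance from the lower grid point to \<open>y\<close>.\<close>
  also have "measure U {c<..} = (y - of_int n * d) / d"
  proof -
    have "{- d / 2 <..< d / 2} \<inter> {c<..} = {c<..<d/2}"
      using y by (auto simp: c_def algebra_simps)
    moreover have "c \<le> d / 2"
      using y by (simp add: c_def algebra_simps)
    ultimately have "measure lborel ({- d / 2 <..< d / 2} \<inter> {c<..}) = y - of_int n * d"
      by (simp add: c_def algebra_simps)
    moreover have "measure lborel {- d / 2 <..< d / 2} = d" using d by simp
    ultimately show ?thesis
      unfolding U_def using d by (subst measure_uniform_measure) auto
  qed
  also have "(\<integral>v. v \<partial>U) = 0"
    unfolding U_def using d by (rule integral_uniform_measure_symmetric)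
  finally show ?thesis using d unfolding U_def by simp
qed

lemma integral_dquant_error:
  assumes "qdelta n U > 0"
  shows "(\<integral>v. dquant n U m v z - z
    \<partial>uniform_measure lborel {- qdelta n U / 2 <..< qdelta n U / 2}) = 0"
  using integral_grid_round_error[OF assms, of "z - m"]
  by (simp add: dquant_eq algebra_simps)

text \<open>The dither is subtracted again, so the error is the plain rounding error of the dithered
  input. All boundedness in the proof originates here.\<close>

lemma dquant_error_bound:
  assumes "qdelta n U > 0"
  shows "\<bar>dquant n U m v z - z\<bar> \<le> qdelta n U / 2"
  using grid_round_error[OF assms, of "z + v - m"]
  unfolding dquant_eq by linarith

lemma borel_measurable_dquant [measurable (raw)]:
  assumes "m \<in> borel_measurable M" "v \<in> borel_measurable M" "z \<in> borel_measurable M"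
  shows "(\<lambda>w. dquant n U (m w) (v w) (z w)) \<in> borel_measurable M"
  unfolding dquant_eq using assms by measurable

section \<open>Vector quantization: measurability and error bounds\<close>

lemma borel_measurable_vec_lambda:
  fixes f :: "'w \<Rightarrow> 'p::finite \<Rightarrow> real"
  assumes "\<And>k. (\<lambda>w. f w k) \<in> borel_measurable M"
  shows "(\<lambda>w. \<chi> k. f w k) \<in> borel_measurable M"
  using assms
  by (subst borel_measurable_euclidean_space) (simp add: Basis_vec_def inner_axis)

lemma borel_measurable_vec_nth [measurable (raw)]:
  fixes f :: "'w \<Rightarrow> real^'p::finite"
  assumes "f \<in> borel_measurable M"
  shows "(\<lambda>w. f w $ k) \<in> borel_measurable M"
proof -
  have "(\<lambda>w. f w \<bullet> axis k 1) \<in> borel_measurable M"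
    using assms by (intro borel_measurable_inner borel_measurable_const)
  then show ?thesis by (simp add: inner_axis)
qed

lemma borel_measurable_matrix_vector_mult [measurable (raw)]:
  fixes f :: "'w \<Rightarrow> real^'p::finite" and A :: "real^'p^'q::finite"
  assumes "f \<in> borel_measurable M"
  shows "(\<lambda>w. A *v f w) \<in> borel_measurable M"
proof (rule measurable_compose[OF assms])
  show "(*v) A \<in> borel_measurable borel"
    by (intro borel_measurable_continuous_onI matrix_vector_mult_linear_continuous_on)
qed

text \<open>The dithers are required to be measurable only on \<open>S\<close>, since random
  variables are given only for the scalars that are actually quantized.\<close>

lemma borel_measurable_vquant:
  assumes "mid \<in> borel_measurable M" "z \<in> borel_measurable M"
    and "\<And>k. k \<in> S \<Longrightarrow> (\<lambda>w. v w k) \<in> borel_measurable M"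
  shows "(\<lambda>w. vquant n U S (mid w) (v w) (z w)) \<in> borel_measurable M"
  unfolding vquant_def
proof (rule borel_measurable_vec_lambda)
  fix k
  show "(\<lambda>w. if k \<in> S then dquant n U (mid w $ k) (v w k) (z w $ k) else 0) \<in> borel_measurable M"
  proof (cases "k \<in> S")
    case True
    then show ?thesis
      using borel_measurable_dquant[OF borel_measurable_vec_nth[OF assms(1)] assms(3)[OF True]
          borel_measurable_vec_nth[OF assms(2)]] by simp
  qed simp
qed

lemma norm_vec_bound:
  fixes x :: "real^'p::finite"
  assumes "\<And>k. \<bar>x $ k\<bar> \<le> c"
  shows "norm x \<le> real CARD('p) * c"
proof -
  have "norm x \<le> (\<Sum>k\<in>UNIV. \<bar>x $ k\<bar>)" by (rule norm_le_l1_cart)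
  also have "\<dots> \<le> (\<Sum>k\<in>(UNIV::'p set). c)" using assms by (rule sum_mono)
  finally show ?thesis by simp
qed

lemma vquant_error_bound:
  fixes z :: "real^'p::finite"
  assumes d: "qdelta n U > 0" and z: "z \<in> coord_space S"
  shows "norm (vquant n U S m v z - z) \<le> real CARD('p) * (qdelta n U / 2)"
proof (rule norm_vec_bound)
  fix k
  show "\<bar>(vquant n U S m v z - z) $ k\<bar> \<le> qdelta n U / 2"
  proof (cases "k \<in> S")
    case True
    then show ?thesis using dquant_error_bound[OF d] by (simp add: vquant_def)
  next
    case False
    then show ?thesis using d z by (simp add: vquant_def coord_space_def)
  qed
qed

text \<open>The sample point itself, seen only through the sub-sigma-algebra \<open>G\<close>,
  serves as the random element independent of \<open>X\<close>; nothing has to be packed into a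
  random variable. The joint law of \<open>(w, X w)\<close> is checked to be a product on
  rectangles, and Fubini integrates out \<open>X\<close> with \<open>w\<close> frozen.\<close>

lemma (in prob_space) expectation_freezing:
  fixes f :: "'a \<times> 'b \<Rightarrow> real"
  assumes sub: "subalgebra M G" and X: "X \<in> measurable M N"
    and indep: "\<And>A B. A \<in> sets G \<Longrightarrow> B \<in> sets N \<Longrightarrow>
      prob (A \<inter> (X -` B \<inter> space M)) = prob A * prob (X -` B \<inter> space M)"
    and f [measurable]: "f \<in> borel_measurable (G \<Otimes>\<^sub>M N)"
    and bound: "\<And>w v. w \<in> space M \<Longrightarrow> \<bar>f (w, v)\<bar> \<le> K"
  shows "(\<integral>w. f (w, X w) \<partial>M) = (\<integral>w. (\<integral>v. f (w, v) \<partial>distr M N X) \<partial>M)"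
proof -
  let ?G = "restr_to_subalg M G"
  have setsG [simp, measurable_cong]: "sets ?G = sets G" and spaceG [simp]: "space ?G = space M"
    using sub by (simp_all add: sets_restr_to_subalg space_restr_to_subalg)
  have spG: "space G = space M" using sub by (simp add: subalgebra_def)
  have id: "(\<lambda>w. w) \<in> measurable M ?G"
    using sub by (auto simp: measurable_def subalgebra_def sets_restr_to_subalg[OF sub] space_restr_to_subalg
        intro: sets.Int)
  interpret G: prob_space ?G
    using sub prob_space_axioms by (rule prob_space_restr_to_subalg)
  interpret N: prob_space "distr M N X" using X by (rule prob_space_distr)
  interpret GN: pair_prob_space ?G "distr M N X" ..
  have pair: "(\<lambda>w. (w, X w)) \<in> measurable M (?G \<Otimes>\<^sub>M N)"
    using id X by (intro measurable_Pair)
  have eq: "?G \<Otimes>\<^sub>M distr M N X = distr M (?G \<Otimes>\<^sub>M N) (\<lambda>w. (w, X w))"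
  proof (rule pair_measure_eqI)
    fix A B
    assume A: "A \<in> sets ?G" and B: "B \<in> sets (distr M N X)"
    have AM: "A \<in> events" using A sub by (auto simp: subalgebra_def sets_restr_to_subalg[OF sub])
    have XB: "X -` B \<inter> space M \<in> events" using X B by (auto intro: measurable_sets)
    have "emeasure (distr M (?G \<Otimes>\<^sub>M N) (\<lambda>w. (w, X w))) (A \<times> B) = emeasure M (A \<inter> (X -` B \<inter> space M))"
    proof (subst emeasure_distr[OF pair])
      show "A \<times> B \<in> sets (?G \<Otimes>\<^sub>M N)" using A B by (intro pair_measureI) auto
      have "(\<lambda>w. (w, X w)) -` (A \<times> B) \<inter> space M = A \<inter> (X -` B \<inter> space M)" by auto
      then show "emeasure M ((\<lambda>w. (w, X w)) -` (A \<times> B) \<inter> space M) = emeasure M (A \<inter> (X -` B \<inter> space M))"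
        by simp
    qed
    also have "\<dots> = emeasure M A * emeasure M (X -` B \<inter> space M)"
      using indep[of A B] A B AM XB by (simp add: emeasure_eq_measure ennreal_mult'')
    finally show "emeasure ?G A * emeasure (distr M N X) B =
      emeasure (distr M (?G \<Otimes>\<^sub>M N) (\<lambda>w. (w, X w))) (A \<times> B)"
      using A B X by (simp add: emeasure_restr_to_subalg[OF sub] emeasure_distr)
  next
    show "sets (?G \<Otimes>\<^sub>M distr M N X) = sets (distr M (?G \<Otimes>\<^sub>M N) (\<lambda>w. (w, X w)))"
      unfolding sets_distr by (rule sets_pair_measure_cong[OF refl sets_distr])
  qed (rule G.sigma_finite_measure_axioms N.sigma_finite_measure_axioms)+
  have fG [measurable]: "f \<in> borel_measurable (?G \<Otimes>\<^sub>M N)"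
    using f by (subst measurable_cong_sets[OF sets_pair_measure_cong[OF setsG refl] refl])
  have fGd: "f \<in> borel_measurable (?G \<Otimes>\<^sub>M distr M N X)"
    using fG by (subst measurable_cong_sets[OF sets_pair_measure_cong[OF refl sets_distr] refl])
  have int: "integrable (?G \<Otimes>\<^sub>M distr M N X) f"
  proof (rule GN.integrable_const_bound[OF _ fGd])
    show "AE p in ?G \<Otimes>\<^sub>M distr M N X. norm (f p) \<le> K"
    proof (rule AE_I2)
      fix p
      assume "p \<in> space (?G \<Otimes>\<^sub>M distr M N X)"
      then have "fst p \<in> space M" by (simp add: space_pair_measure mem_Times_iff)
      then show "norm (f p) \<le> K" using bound[of "fst p" "snd p"] by simp
    qed
  qed
  have "(\<integral>w. f (w, X w) \<partial>M) = (\<integral>p. f p \<partial>distr M (?G \<Otimes>\<^sub>M N) (\<lambda>w. (w, X w)))"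
    using pair fG by (rule integral_distr[symmetric])
  also have "\<dots> = (\<integral>w. (\<integral>v. f (w, v) \<partial>distr M N X) \<partial>?G)"
    unfolding eq[symmetric] using int by (rule GN.integral_fst'[symmetric])
  also have "\<dots> = (\<integral>w. (\<integral>v. f (w, v) \<partial>distr M N X) \<partial>M)"
    using GN.integrable_fst'[OF int] measurable_cong_sets[OF setsG refl]
    by (intro integral_subalgebra2[OF sub]) auto
  finally show ?thesis .
qed

section \<open>Equivalence with the inexact Prox-SVRG recursion\<close>

lemma selmat_mult_nth: "(selmat S *v x) $ k = (if k \<in> S then x $ k else 0)"
proof -
  have "(selmat S *v x) $ k = (\<Sum>j\<in>UNIV. if j = k then (if k \<in> S then x $ k else 0) else 0)"
    unfolding selmat_def matrix_vector_mult_def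
    by (subst vec_lambda_beta, intro sum.cong) auto
  then show ?thesis by simp
qed

lemma transpose_selmat [simp]: "transpose (selmat S) = selmat S"
  by (auto simp: transpose_def selmat_def vec_eq_iff)

lemma selmat_in_coord_space: "selmat S *v x \<in> coord_space S"
  by (simp add: coord_space_def selmat_mult_nth)

lemma selmat_mult_id: "x \<in> coord_space S \<Longrightarrow> selmat S *v x = x"
  by (auto simp: coord_space_def selmat_mult_nth vec_eq_iff)

lemma Amat_in_coord_space: "Amat P i *v x \<in> coord_space (nbh_coords P i)"
  by (simp add: Amat_def selmat_in_coord_space)

lemma transpose_Amat [simp]: "transpose (Amat P i) = Amat P i"
  by (simp add: Amat_def)

lemma Amat_mult_id: "x \<in> coord_space (nbh_coords P i) \<Longrightarrow> Amat P i *v x = x"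
  by (simp add: Amat_def selmat_mult_id)

lemma Amat_mult_nth: "(Amat P i *v x) $ k = (if k \<in> nbh_coords P i then x $ k else 0)"
  by (simp add: Amat_def selmat_mult_nth)

lemma coord_space_diff: "x \<in> coord_space S \<Longrightarrow> y \<in> coord_space S \<Longrightarrow> x - y \<in> coord_space S"
  by (simp add: coord_space_def)

lemma coord_space_scaleR: "x \<in> coord_space S \<Longrightarrow> c *\<^sub>R x \<in> coord_space S"
  by (simp add: coord_space_def)

lemma coord_space_sum: "(\<And>j. j \<in> J \<Longrightarrow> x j \<in> coord_space S) \<Longrightarrow> sum x J \<in> coord_space S"
  by (simp add: coord_space_def)

lemma vquant_in_coord_space: "vquant n U S m v z \<in> coord_space S"
  by (simp add: coord_space_def vquant_def)

text \<open>Concatenation is encoded as a sum, so a block can be recovered from \<open>conc\<close>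
  only if every block vanishes off its own coordinates.\<close>

definition supported_blocks :: "('n::finite, 'p::finite) isgd \<Rightarrow> ('n, 'p) blocks \<Rightarrow> bool" where
  "supported_blocks P y \<longleftrightarrow> (\<forall>i. y i \<in> coord_space (own_coords P i))"

lemma conc_nth:
  assumes "supported_blocks P y"
  shows "conc y $ k = y (owner P k) $ k"
proof -
  have "conc y $ k = (\<Sum>i\<in>UNIV. if i = owner P k then y i $ k else 0)"
    using assms unfolding conc_def sum_component
    by (intro sum.cong) (auto simp: supported_blocks_def coord_space_def own_coords_def)
  then show ?thesis by simp
qed

lemma conc_scaleR_sum: "conc (\<lambda>i. c *\<^sub>R (\<Sum>t\<in>J. y t i)) = c *\<^sub>R (\<Sum>t\<in>J. conc (y t))"
  unfolding conc_def by (subst sum.swap) (simp add: scaleR_sum_right)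

lemma supported_blocks_conc:
  assumes "supported_blocks P y"
  shows "selmat (own_coords P i) *v conc y = y i"
  using assms
  by (auto simp: vec_eq_iff selmat_mult_nth conc_nth own_coords_def supported_blocks_def coord_space_def)

lemma xtil_0: "xtil P \<nu> nd 0 = (\<lambda>_. 0)"
  and xthat_prev_0: "xthat_prev P \<nu> nd 0 = (\<lambda>_. 0)"
  and ghat_prev_0: "ghat_prev P \<nu> nd 0 = (\<lambda>_. 0)"
  by (simp_all add: xtil_def xthat_prev_def ghat_prev_def)

lemma xtil_Suc: "xtil P \<nu> nd (Suc s) =
    (\<lambda>i. (1 / real (inner_len P)) *\<^sub>R (\<Sum>t = 1..inner_len P. xin P \<nu> nd s t i))"
  and xthat_prev_Suc: "xthat_prev P \<nu> nd (Suc s) = xthat P \<nu> nd s"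
  and ghat_prev_Suc: "ghat_prev P \<nu> nd (Suc s) = ghat P \<nu> nd s"
  by (simp_all add: xtil_def xthat_prev_def ghat_prev_def xthat_def ghat_def xin_def Let_def
      case_prod_beta)

lemma xin_0: "xin P \<nu> nd s 0 = xtil P \<nu> nd s"
  by (simp add: xin_def)

lemma xin_Suc: "xin P \<nu> nd s (Suc t) =
  (\<lambda>i. if i \<in> nbh P (nd s t)
       then prox_block P i (xin P \<nu> nd s t i - stepsize P *\<^sub>R
         (Bmat P (nd s t) i *v ginhat P \<nu> nd s t - Bmat P (nd s t) i *v ghat P \<nu> nd s (nd s t)
           + avg_grad P (ghat P \<nu> nd s) i))
       else prox_block P i (xin P \<nu> nd s t i - stepsize P *\<^sub>R avg_grad P (ghat P \<nu> nd s) i))"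
  unfolding xin_def ginhat_def xinhat_def inner_loop.simps inner_step_def Let_def by (rule refl)

lemma prox_block_in_coord_space: "prox_block P i x \<in> coord_space (own_coords P i)"
  by (simp add: prox_block_def selmat_in_coord_space)

lemma supported_blocks_xin_if:
  "supported_blocks P (xtil P \<nu> nd s) \<Longrightarrow> supported_blocks P (xin P \<nu> nd s t)"
  by (cases t) (simp_all add: xin_0 xin_Suc supported_blocks_def prox_block_in_coord_space)

lemma supported_blocks_xtil: "supported_blocks P (xtil P \<nu> nd s)"
proof (induction s)
  case 0
  then show ?case by (simp add: xtil_0 supported_blocks_def coord_space_def)
next
  case (Suc s)
  from supported_blocks_xin_if[OF this] show ?case
    by (simp add: xtil_Suc supported_blocks_def coord_space_scaleR coord_space_sum)
qed

lemmas supported_blocks_xin = supported_blocks_xin_if[OF supported_blocks_xtil]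

lemma supported_blocks_xthat: "supported_blocks P (xthat P \<nu> nd s)"
  by (simp add: supported_blocks_def xthat_def quantA_def vquant_in_coord_space)

lemma supported_blocks_xinhat: "supported_blocks P (xinhat P \<nu> nd s t)"
  by (simp add: supported_blocks_def xinhat_def quantC_def vquant_in_coord_space)

text \<open>The exact gradients in \<open>svrg_dir\<close> cancel against those subtracted in
  \<open>svrg_err\<close>. What remains consists of transmitted quantities, which are what the nodes
  combine.\<close>

lemma svrg_dir_eq:
  "svrg_dir P \<nu> nd s t = Amat P (nd s t) *v ginhat P \<nu> nd s t
     - Amat P (nd s t) *v ghat P \<nu> nd s (nd s t)
     + (1 / real CARD('n)) *\<^sub>R (\<Sum>i\<in>UNIV. Amat P i *v ghat P \<nu> nd s i)"
  for P :: "('n::finite, 'p::finite) isgd"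
  by (simp add: svrg_dir_def svrg_err_def Let_def err_d_def err_b_def grads_def
      matrix_vector_mult_diff_distrib sum_subtractf scaleR_diff_right)

lemma nbh_sym: "sym (edges P) \<Longrightarrow> i \<in> nbh P j \<longleftrightarrow> j \<in> nbh P i"
  by (auto simp: nbh_def sym_def)

lemma mem_nbh_coords: "k \<in> nbh_coords P i \<longleftrightarrow> owner P k \<in> nbh P i"
  and mem_own_coords: "k \<in> own_coords P i \<longleftrightarrow> owner P k = i"
  by (auto simp: nbh_coords_def own_coords_def)

lemma Bmat_mult_nth:
  "(Bmat P i j *v x) $ k = (if owner P k = j \<and> j \<in> nbh P i then x $ k else 0)"
  by (auto simp: Bmat_def selmat_mult_nth mem_nbh_coords mem_own_coords)

text \<open>Node \<open>i\<close> sums over its own neighborhood, the global average over all nodes.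
  On the block of \<open>i\<close> the matrix \<open>Amat P j\<close> keeps \<open>g j\<close>
  exactly when \<open>i \<in> nbh P j\<close>, and by symmetry of the edges these \<open>j\<close>
  form \<open>nbh P i\<close>.\<close>

lemma avg_grad_eq:
  fixes P :: "('n::finite, 'p::finite) isgd"
  assumes "sym (edges P)"
  shows "avg_grad P g i =
    selmat (own_coords P i) *v ((1 / real CARD('n)) *\<^sub>R (\<Sum>j\<in>UNIV. Amat P j *v g j))"
proof (rule vec_eq_iff[THEN iffD2, rule_format])
  fix k
  have "(\<Sum>j\<in>nbh P i. (Bmat P j i *v g j) $ k) =
      (if owner P k = i then \<Sum>j\<in>nbh P i. g j $ k else 0)"
    using nbh_sym[OF assms] by (auto simp: Bmat_mult_nth intro!: sum.cong sum.neutral)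
  moreover have "(\<Sum>j\<in>UNIV. (Amat P j *v g j) $ k) = (\<Sum>j\<in>nbh P i. g j $ k)" if "owner P k = i"
  proof -
    have "(\<Sum>j\<in>UNIV. (Amat P j *v g j) $ k) = (\<Sum>j\<in>UNIV. if j \<in> nbh P i then g j $ k else 0)"
      using that nbh_sym[OF assms] by (intro sum.cong) (auto simp: Amat_mult_nth mem_nbh_coords)
    then show ?thesis by (simp add: sum.If_cases)
  qed
  ultimately show "avg_grad P g i $ k =
    (selmat (own_coords P i) *v ((1 / real CARD('n)) *\<^sub>R (\<Sum>j\<in>UNIV. Amat P j *v g j))) $ k"
    by (simp add: avg_grad_def selmat_mult_nth mem_own_coords)
qed

lemma conc_xin_Suc:
  fixes P :: "('n::finite, 'p::finite) isgd"
  assumes sym: "sym (edges P)"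
    and blockwise: "\<And>x. gprox P x = conc (\<lambda>i. prox_block P i (selmat (own_coords P i) *v x))"
  shows "conc (xin P \<nu> nd s (Suc t)) =
    gprox P (conc (xin P \<nu> nd s t) - stepsize P *\<^sub>R svrg_dir P \<nu> nd s t)"
proof -
  let ?l = "nd s t" and ?x = "xin P \<nu> nd s t" and ?g = "ghat P \<nu> nd s" and ?g' = "ginhat P \<nu> nd s t"
  have B: "Bmat P ?l i *v y = selmat (own_coords P i) *v (Amat P ?l *v y)" for i y
    by (auto simp: vec_eq_iff Bmat_mult_nth selmat_mult_nth Amat_mult_nth mem_nbh_coords mem_own_coords)
  \<comment> \<open>Outside the neighborhood of the drawn node the correction vanishes, so both
    branches of the local update are one formula.\<close>
  have B0: "Bmat P ?l i *v y = 0" if "i \<notin> nbh P ?l" for i y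
    using that by (simp add: vec_eq_iff Bmat_mult_nth)
  \<comment> \<open>Block \<open>i\<close> of the global gradient step is the argument of the local
    proximal step, as the blockwise assumption demands.\<close>
  have "selmat (own_coords P i) *v (conc ?x - stepsize P *\<^sub>R svrg_dir P \<nu> nd s t) =
      ?x i - stepsize P *\<^sub>R (Bmat P ?l i *v ?g' - Bmat P ?l i *v ?g ?l + avg_grad P ?g i)" for i
    unfolding svrg_dir_eq avg_grad_eq[OF sym] B
    by (simp only: matrix_vector_mult_diff_distrib matrix_vector_mult_scaleR
        matrix_vector_right_distrib supported_blocks_conc[OF supported_blocks_xin])
  then show ?thesis
    unfolding blockwise xin_Suc by (intro arg_cong[where f = conc]) (auto simp: B0)
qed

lemma conc_xtil_Suc:
  "conc (xtil P \<nu> nd (Suc s)) =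
    (1 / real (inner_len P)) *\<^sub>R (\<Sum>t = 1..inner_len P. conc (xin P \<nu> nd s t))"
  unfolding xtil_Suc by (rule conc_scaleR_sum)

section \<open>Measurability of the iterates\<close>

definition sources :: "('n::finite, 'p::finite) isgd \<Rightarrow> ((nat \<times> nat) + ('n, 'p) dither) set" where
  "sources P = Inl ` {(s, t). t < inner_len P} \<union> Inr ` dithers P"

text \<open>The dithers of \<open>xthat s\<close> and \<open>ghat s\<close> count as earlier than inner iteration \<open>(s, 0)\<close>.\<close>

fun before :: "nat \<Rightarrow> nat \<Rightarrow> (nat \<times> nat) + ('n, 'p) dither \<Rightarrow> bool" where
  "before s t (Inl (s', t')) \<longleftrightarrow> s' < s \<or> s' = s \<and> t' < t"
| "before s t (Inr (DA s' k)) \<longleftrightarrow> s' \<le> s"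
| "before s t (Inr (DB s' i k)) \<longleftrightarrow> s' \<le> s"
| "before s t (Inr (DC s' t' k)) \<longleftrightarrow> s' < s \<or> s' = s \<and> t' < t"
| "before s t (Inr (DD s' t' l k)) \<longleftrightarrow> s' < s \<or> s' = s \<and> t' < t"

lemma before_Suc: "before s t \<kappa> \<Longrightarrow> before s (Suc t) \<kappa>"
  by (induction s t \<kappa> rule: before.induct) auto

lemma before_outer_Suc: "before s t \<kappa> \<Longrightarrow> before (Suc s) 0 \<kappa>"
  by (induction s t \<kappa> rule: before.induct) auto

fun source_measurable ::
  "'w measure \<Rightarrow> ('w \<Rightarrow> ('n, 'p) dither \<Rightarrow> real) \<Rightarrow> ('w \<Rightarrow> nat \<Rightarrow> nat \<Rightarrow> 'n) \<Rightarrow>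
   (nat \<times> nat) + ('n, 'p) dither \<Rightarrow> bool" where
  "source_measurable G \<nu> nd (Inl st) \<longleftrightarrow>
     (\<lambda>\<omega>. nd \<omega> (fst st) (snd st)) \<in> measurable G (count_space UNIV)"
| "source_measurable G \<nu> nd (Inr \<delta>) \<longleftrightarrow> (\<lambda>\<omega>. \<nu> \<omega> \<delta>) \<in> borel_measurable G"

text \<open>\<open>G\<close> is a parameter because the iterates must be measurable both for
  \<open>M\<close> and for each sigma-algebra that leaves out one source.\<close>

locale isgd_measurable =
  fixes P :: "('n::finite, 'p::finite) isgd"
    and G :: "'w measure"
    and \<nu> :: "'w \<Rightarrow> ('n, 'p) dither \<Rightarrow> real"
    and nd :: "'w \<Rightarrow> nat \<Rightarrow> nat \<Rightarrow> 'n"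
  assumes problem: "isgd_problem P"
begin

lemma gprox_measurable: "gprox P \<in> borel_measurable borel"
  unfolding gprox_def using problem by (intro borel_measurable_prox) (auto simp: isgd_problem_def)

text \<open>\<open>gradl P i\<close> is arbitrary off its coordinate subspace; after
  \<open>Amat P i\<close> only its affine part is seen.\<close>

lemma gradl_Amat_measurable:
  "(\<lambda>x. gradl P i (Amat P i *v x)) \<in> borel_measurable borel"
proof -
  obtain H h where "\<forall>z \<in> coord_space (nbh_coords P i). gradl P i z = H *v z + h"
    using problem unfolding isgd_problem_def by metis
  then have "(\<lambda>x. gradl P i (Amat P i *v x)) = (\<lambda>x. H *v (Amat P i *v x) + h)"
    using Amat_in_coord_space[of P i] by auto
  moreover have "(\<lambda>x. H *v (Amat P i *v x) + h) \<in> borel_measurable borel"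
    by (intro borel_measurable_add borel_measurable_matrix_vector_mult) auto
  ultimately show ?thesis by simp
qed

definition blocks_measurable :: "('w \<Rightarrow> ('n, 'p) blocks) \<Rightarrow> bool" where
  "blocks_measurable y \<longleftrightarrow> (\<forall>i. (\<lambda>\<omega>. y \<omega> i) \<in> borel_measurable G)"

lemma conc_measurable: "blocks_measurable y \<Longrightarrow> (\<lambda>\<omega>. conc (y \<omega>)) \<in> borel_measurable G"
  unfolding conc_def blocks_measurable_def by (intro borel_measurable_sum) auto

lemma grads_measurable:
  assumes "blocks_measurable y"
  shows "blocks_measurable (\<lambda>\<omega>. grads P (y \<omega>))"
  using measurable_compose[OF conc_measurable[OF assms] gradl_Amat_measurable]
  by (simp add: blocks_measurable_def grads_def)

lemma avg_grad_measurable: "blocks_measurable y \<Longrightarrow> blocks_measurable (\<lambda>\<omega>. avg_grad P (y \<omega>))"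
  unfolding blocks_measurable_def avg_grad_def
  by (intro allI borel_measurable_scaleR borel_measurable_const borel_measurable_sum
      borel_measurable_matrix_vector_mult) auto

lemma prox_block_measurable:
  "f \<in> borel_measurable G \<Longrightarrow> (\<lambda>\<omega>. prox_block P i (f \<omega>)) \<in> borel_measurable G"
  unfolding prox_block_def
  by (intro borel_measurable_matrix_vector_mult measurable_compose[OF _ gprox_measurable])

lemma xthat_measurable:
  assumes "blocks_measurable (\<lambda>\<omega>. xtil P (\<nu> \<omega>) (nd \<omega>) s)"
    and "blocks_measurable (\<lambda>\<omega>. xthat_prev P (\<nu> \<omega>) (nd \<omega>) s)"
    and "\<And>k. source_measurable G \<nu> nd (Inr (DA s k))"
  shows "blocks_measurable (\<lambda>\<omega>. xthat P (\<nu> \<omega>) (nd \<omega>) s)"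
  using assms unfolding blocks_measurable_def xthat_def quantA_def
  by (intro allI borel_measurable_vquant) auto

lemma ghat_measurable:
  assumes "blocks_measurable (\<lambda>\<omega>. xthat P (\<nu> \<omega>) (nd \<omega>) s)"
    and "blocks_measurable (\<lambda>\<omega>. ghat_prev P (\<nu> \<omega>) (nd \<omega>) s)"
    and "\<And>i k. k \<in> nbh_coords P i \<Longrightarrow> source_measurable G \<nu> nd (Inr (DB s i k))"
  shows "blocks_measurable (\<lambda>\<omega>. ghat P (\<nu> \<omega>) (nd \<omega>) s)"
  using grads_measurable[OF assms(1)] assms(2,3)
  unfolding blocks_measurable_def ghat_def quantB_def
  by (intro allI borel_measurable_vquant) auto

lemma xinhat_measurable:
  assumes "blocks_measurable (\<lambda>\<omega>. xthat P (\<nu> \<omega>) (nd \<omega>) s)"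
    and "blocks_measurable (\<lambda>\<omega>. xin P (\<nu> \<omega>) (nd \<omega>) s t)"
    and "\<And>k. source_measurable G \<nu> nd (Inr (DC s t k))"
  shows "blocks_measurable (\<lambda>\<omega>. xinhat P (\<nu> \<omega>) (nd \<omega>) s t)"
  using assms unfolding blocks_measurable_def xinhat_def quantC_def
  by (intro allI borel_measurable_vquant) auto

lemma ginhat_measurable:
  assumes "blocks_measurable (\<lambda>\<omega>. ghat P (\<nu> \<omega>) (nd \<omega>) s)"
    and "blocks_measurable (\<lambda>\<omega>. xinhat P (\<nu> \<omega>) (nd \<omega>) s t)"
    and "source_measurable G \<nu> nd (Inl (s, t))"
    and "\<And>l k. k \<in> nbh_coords P l \<Longrightarrow> source_measurable G \<nu> nd (Inr (DD s t l k))"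
  shows "(\<lambda>\<omega>. ginhat P (\<nu> \<omega>) (nd \<omega>) s t) \<in> borel_measurable G"
  unfolding ginhat_def
\<comment> \<open>The drawn node is random but has finitely many values, so measurability is checked
  for each fixed node.\<close>
proof (rule measurable_compose_countable)
  fix l
  show "(\<lambda>\<omega>. quantD P (\<nu> \<omega>) s t l (ghat P (\<nu> \<omega>) (nd \<omega>) s l)
      (grads P (xinhat P (\<nu> \<omega>) (nd \<omega>) s t) l)) \<in> borel_measurable G"
    using grads_measurable[OF assms(2)] assms(1,4)
    unfolding blocks_measurable_def quantD_def
    by (intro borel_measurable_vquant) auto
qed (use assms(3) in simp)

lemma xin_Suc_measurable:
  assumes x: "blocks_measurable (\<lambda>\<omega>. xin P (\<nu> \<omega>) (nd \<omega>) s t)"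
    and g: "blocks_measurable (\<lambda>\<omega>. ghat P (\<nu> \<omega>) (nd \<omega>) s)"
    and g': "(\<lambda>\<omega>. ginhat P (\<nu> \<omega>) (nd \<omega>) s t) \<in> borel_measurable G"
    and nd: "source_measurable G \<nu> nd (Inl (s, t))"
  shows "blocks_measurable (\<lambda>\<omega>. xin P (\<nu> \<omega>) (nd \<omega>) s (Suc t))"
  unfolding blocks_measurable_def xin_Suc
proof
  fix i
  let ?f = "\<lambda>l \<omega>. if i \<in> nbh P l
      then prox_block P i (xin P (\<nu> \<omega>) (nd \<omega>) s t i - stepsize P *\<^sub>R
        (Bmat P l i *v ginhat P (\<nu> \<omega>) (nd \<omega>) s t - Bmat P l i *v ghat P (\<nu> \<omega>) (nd \<omega>) s l
          + avg_grad P (ghat P (\<nu> \<omega>) (nd \<omega>) s) i))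
      else prox_block P i (xin P (\<nu> \<omega>) (nd \<omega>) s t i
        - stepsize P *\<^sub>R avg_grad P (ghat P (\<nu> \<omega>) (nd \<omega>) s) i)"
  have m: "(\<lambda>\<omega>. xin P (\<nu> \<omega>) (nd \<omega>) s t i) \<in> borel_measurable G"
    "\<And>l. (\<lambda>\<omega>. ghat P (\<nu> \<omega>) (nd \<omega>) s l) \<in> borel_measurable G"
    "(\<lambda>\<omega>. avg_grad P (ghat P (\<nu> \<omega>) (nd \<omega>) s) i) \<in> borel_measurable G"
    using x g avg_grad_measurable[OF g] unfolding blocks_measurable_def by auto
  have "?f l \<in> borel_measurable G" for l
  proof (cases "i \<in> nbh P l")
    case True
    show ?thesis unfolding if_P[OF True]
      by (intro prox_block_measurable borel_measurable_diff borel_measurable_scaleR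
          borel_measurable_add borel_measurable_const borel_measurable_matrix_vector_mult m g')
  next
    case False
    show ?thesis unfolding if_not_P[OF False]
      by (intro prox_block_measurable borel_measurable_diff borel_measurable_scaleR
          borel_measurable_const m)
  qed
  moreover have "(\<lambda>\<omega>. nd \<omega> s t) \<in> measurable G (count_space UNIV)" using nd by simp
  ultimately show "(\<lambda>\<omega>. ?f (nd \<omega> s t) \<omega>) \<in> borel_measurable G"
    by (rule measurable_compose_countable)
qed

text \<open>The restriction to \<open>sources P\<close> matters: \<open>before\<close> also holds
  for keys, such as inner steps beyond \<open>inner_len P\<close>, about which the randomness
  assumption says nothing.\<close>

definition past_measurable :: "nat \<Rightarrow> nat \<Rightarrow> bool" where
  "past_measurable s t \<longleftrightarrow> (\<forall>\<kappa>\<in>sources P. before s t \<kappa> \<longrightarrow> source_measurable G \<nu> nd \<kappa>)"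

lemma past_measurable_SucD: "past_measurable s (Suc t) \<Longrightarrow> past_measurable s t"
  using before_Suc by (auto simp: past_measurable_def)

lemma past_measurable_outer_SucD: "past_measurable (Suc s) 0 \<Longrightarrow> past_measurable s t"
  using before_outer_Suc by (auto simp: past_measurable_def)

lemma past_measurable_0D: "past_measurable s t \<Longrightarrow> past_measurable s 0"
  by (induction t) (auto dest: past_measurable_SucD)

lemma past_measurableD:
  assumes "past_measurable s t"
  shows "source_measurable G \<nu> nd (Inr (DA s k))"
    and "k \<in> nbh_coords P i \<Longrightarrow> source_measurable G \<nu> nd (Inr (DB s i k))"
    and "t' < t \<Longrightarrow> t' < inner_len P \<Longrightarrow> source_measurable G \<nu> nd (Inl (s, t'))"
    and "t' < t \<Longrightarrow> t' < inner_len P \<Longrightarrow> source_measurable G \<nu> nd (Inr (DC s t' k))"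
    and "t' < t \<Longrightarrow> t' < inner_len P \<Longrightarrow> k \<in> nbh_coords P i \<Longrightarrow>
      source_measurable G \<nu> nd (Inr (DD s t' i k))"
proof -
  have "Inr (DA s k) \<in> sources P"
    "k \<in> nbh_coords P i \<Longrightarrow> Inr (DB s i k) \<in> sources P"
    "t' < inner_len P \<Longrightarrow> Inl (s, t') \<in> sources P"
    "t' < inner_len P \<Longrightarrow> Inr (DC s t' k) \<in> sources P"
    "t' < inner_len P \<Longrightarrow> k \<in> nbh_coords P i \<Longrightarrow> Inr (DD s t' i k) \<in> sources P"
    by (auto simp: sources_def dithers_def)
  moreover have "\<And>\<kappa>. \<kappa> \<in> sources P \<Longrightarrow> before s t \<kappa> \<Longrightarrow> source_measurable G \<nu> nd \<kappa>"
    using assms by (simp add: past_measurable_def)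
  ultimately show "source_measurable G \<nu> nd (Inr (DA s k))"
    and "k \<in> nbh_coords P i \<Longrightarrow> source_measurable G \<nu> nd (Inr (DB s i k))"
    and "t' < t \<Longrightarrow> t' < inner_len P \<Longrightarrow> source_measurable G \<nu> nd (Inl (s, t'))"
    and "t' < t \<Longrightarrow> t' < inner_len P \<Longrightarrow> source_measurable G \<nu> nd (Inr (DC s t' k))"
    and "t' < t \<Longrightarrow> t' < inner_len P \<Longrightarrow> k \<in> nbh_coords P i \<Longrightarrow>
      source_measurable G \<nu> nd (Inr (DD s t' i k))"
    by (metis before.simps(1-5) order_refl)+
qed

lemma xin_measurable_if:
  assumes "blocks_measurable (\<lambda>\<omega>. xtil P (\<nu> \<omega>) (nd \<omega>) s)"
    and x: "blocks_measurable (\<lambda>\<omega>. xthat P (\<nu> \<omega>) (nd \<omega>) s)"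
    and g: "blocks_measurable (\<lambda>\<omega>. ghat P (\<nu> \<omega>) (nd \<omega>) s)"
    and "past_measurable s t" "t \<le> inner_len P"
  shows "blocks_measurable (\<lambda>\<omega>. xin P (\<nu> \<omega>) (nd \<omega>) s t)"
  using assms(4,5)
proof (induction t)
  case 0
  then show ?case using assms(1) by (simp add: xin_0)
next
  case (Suc t)
  have IH: "blocks_measurable (\<lambda>\<omega>. xin P (\<nu> \<omega>) (nd \<omega>) s t)"
    using Suc past_measurable_SucD by simp
  \<comment> \<open>Iterate \<open>Suc t\<close> consumes the sources of step \<open>t\<close>, so
    iterates up to and including \<open>inner_len P\<close> are covered.\<close>
  have t: "t < Suc t" "t < inner_len P" using Suc.prems by auto
  note src = past_measurableD(3-5)[OF Suc.prems(1) t]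
  show ?case
    by (rule xin_Suc_measurable[OF IH g ginhat_measurable[OF g xinhat_measurable[OF x IH src(2)] src(1) src(3)] src(1)])
qed

text \<open>A joint induction, because the midpoints of one outer iteration are the quantized values
  of the previous one and the new iterate averages inner iterates built from all three.\<close>

lemma outer_state_measurable:
  assumes "past_measurable s 0"
  shows "blocks_measurable (\<lambda>\<omega>. xtil P (\<nu> \<omega>) (nd \<omega>) s)"
    and "blocks_measurable (\<lambda>\<omega>. xthat P (\<nu> \<omega>) (nd \<omega>) s)"
    and "blocks_measurable (\<lambda>\<omega>. ghat P (\<nu> \<omega>) (nd \<omega>) s)"
proof -
  have "blocks_measurable (\<lambda>\<omega>. xtil P (\<nu> \<omega>) (nd \<omega>) s) \<and>
      blocks_measurable (\<lambda>\<omega>. xthat P (\<nu> \<omega>) (nd \<omega>) s) \<and>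
      blocks_measurable (\<lambda>\<omega>. ghat P (\<nu> \<omega>) (nd \<omega>) s)"
    using assms
  proof (induction s)
    case 0
    have 1: "blocks_measurable (\<lambda>\<omega>. xtil P (\<nu> \<omega>) (nd \<omega>) 0)"
      by (simp add: xtil_0 blocks_measurable_def)
    have 2: "blocks_measurable (\<lambda>\<omega>. xthat P (\<nu> \<omega>) (nd \<omega>) 0)"
      using 1 past_measurableD(1)[OF 0]
      by (intro xthat_measurable) (simp_all add: xthat_prev_0 blocks_measurable_def)
    have "blocks_measurable (\<lambda>\<omega>. ghat P (\<nu> \<omega>) (nd \<omega>) 0)"
      using past_measurableD(2)[OF 0] 2
      by (intro ghat_measurable) (simp_all add: ghat_prev_0 blocks_measurable_def)
    with 1 2 show ?case by simp
  next
    case (Suc s)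
    note IH = Suc.IH[OF past_measurable_outer_SucD[OF Suc.prems]]
    have "blocks_measurable (\<lambda>\<omega>. xin P (\<nu> \<omega>) (nd \<omega>) s t)" if "t \<le> inner_len P" for t
      using IH past_measurable_outer_SucD[OF Suc.prems] that by (intro xin_measurable_if) auto
    then have 1: "blocks_measurable (\<lambda>\<omega>. xtil P (\<nu> \<omega>) (nd \<omega>) (Suc s))"
      unfolding blocks_measurable_def xtil_Suc
      by (intro allI borel_measurable_scaleR borel_measurable_const borel_measurable_sum) auto
    have 2: "blocks_measurable (\<lambda>\<omega>. xthat P (\<nu> \<omega>) (nd \<omega>) (Suc s))"
      using 1 IH past_measurableD(1)[OF Suc.prems]
      by (intro xthat_measurable) (simp_all add: xthat_prev_Suc)
    have "blocks_measurable (\<lambda>\<omega>. ghat P (\<nu> \<omega>) (nd \<omega>) (Suc s))"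
      using past_measurableD(2)[OF Suc.prems] IH 2
      by (intro ghat_measurable) (simp_all add: ghat_prev_Suc)
    with 1 2 show ?case by simp
  qed
  then show "blocks_measurable (\<lambda>\<omega>. xtil P (\<nu> \<omega>) (nd \<omega>) s)"
    and "blocks_measurable (\<lambda>\<omega>. xthat P (\<nu> \<omega>) (nd \<omega>) s)"
    and "blocks_measurable (\<lambda>\<omega>. ghat P (\<nu> \<omega>) (nd \<omega>) s)"
    by simp_all
qed

lemma xin_measurable:
  assumes "past_measurable s t" "t \<le> inner_len P"
  shows "blocks_measurable (\<lambda>\<omega>. xin P (\<nu> \<omega>) (nd \<omega>) s t)"
  using outer_state_measurable[OF past_measurable_0D[OF assms(1)]] assms
  by (intro xin_measurable_if)

end

section \<open>Independence of the sources of randomness\<close>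

text \<open>The bound holds at every point and does not mention a measure, so the notion passes
  between sigma-algebras, is preserved by all operations on error terms, and gives integrability at
  once.\<close>

definition bounded_measurable :: "'w measure \<Rightarrow> ('w \<Rightarrow> 'b::euclidean_space) \<Rightarrow> bool" where
  "bounded_measurable G f \<longleftrightarrow> f \<in> borel_measurable G \<and> (\<exists>K. \<forall>w. norm (f w) \<le> K)"

lemma bounded_measurableI:
  "f \<in> borel_measurable G \<Longrightarrow> (\<And>w. norm (f w) \<le> K) \<Longrightarrow> bounded_measurable G f"
  unfolding bounded_measurable_def by blast

lemma bounded_measurableD: "bounded_measurable G f \<Longrightarrow> f \<in> borel_measurable G"
  by (simp add: bounded_measurable_def)

lemma bounded_measurable_const: "bounded_measurable G (\<lambda>w. c)"
  by (rule bounded_measurableI) auto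

lemma bounded_measurable_add:
  assumes "bounded_measurable G f" "bounded_measurable G g"
  shows "bounded_measurable G (\<lambda>w. f w + g w)"
proof -
  obtain K L where "\<And>w. norm (f w) \<le> K" "\<And>w. norm (g w) \<le> L"
    using assms unfolding bounded_measurable_def by blast
  then show ?thesis
    using assms by (intro bounded_measurableI[where K = "K + L"] norm_triangle_mono)
      (auto simp: bounded_measurable_def)
qed

lemma bounded_measurable_bounded_linear:
  assumes "bounded_measurable G f" "bounded_linear h"
  shows "bounded_measurable G (\<lambda>w. h (f w))"
proof -
  obtain K where K: "\<And>w. norm (f w) \<le> K"
    using assms unfolding bounded_measurable_def by blast
  obtain L where L: "L \<ge> 0" "\<And>x. norm (h x) \<le> norm x * L"
    using bounded_linear.nonneg_bounded[OF assms(2)] by blast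
  show ?thesis
  proof (rule bounded_measurableI)
    show "(\<lambda>w. h (f w)) \<in> borel_measurable G"
      by (rule measurable_compose[OF bounded_measurableD[OF assms(1)] borel_measurable_continuous_onI],
          rule bounded_linear.continuous_on[OF assms(2) continuous_on_id])
    show "norm (h (f w)) \<le> K * L" for w
      using L(2)[of "f w"] mult_right_mono[OF K[of w] L(1)] by linarith
  qed
qed

lemma bounded_measurable_minus:
  "bounded_measurable G f \<Longrightarrow> bounded_measurable G (\<lambda>w. - f w)"
  by (erule bounded_measurable_bounded_linear) (rule bounded_linear_minus[OF bounded_linear_ident])

lemma bounded_measurable_diff:
  assumes "bounded_measurable G f" "bounded_measurable G g"
  shows "bounded_measurable G (\<lambda>w. f w - g w)"
  using bounded_measurable_add[OF assms(1) bounded_measurable_minus[OF assms(2)]] by simp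

lemma bounded_measurable_scaleR:
  "bounded_measurable G f \<Longrightarrow> bounded_measurable G (\<lambda>w. c *\<^sub>R f w)"
  by (erule bounded_measurable_bounded_linear) (rule bounded_linear_scaleR_right)

lemma bounded_measurable_matrix_vector_mult:
  fixes f :: "'w \<Rightarrow> real^'p::finite"
  shows "bounded_measurable G f \<Longrightarrow> bounded_measurable G (\<lambda>w. A *v f w)"
  by (erule bounded_measurable_bounded_linear) simp

lemma bounded_measurable_nth:
  fixes f :: "'w \<Rightarrow> real^'p::finite"
  shows "bounded_measurable G f \<Longrightarrow> bounded_measurable G (\<lambda>w. f w $ k)"
  by (erule bounded_measurable_bounded_linear) (rule bounded_linear_vec_nth)

lemma bounded_measurable_sum:
  "(\<And>i. i \<in> I \<Longrightarrow> bounded_measurable G (f i)) \<Longrightarrow> bounded_measurable G (\<lambda>w. \<Sum>i\<in>I. f i w)"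
proof (induction I rule: infinite_finite_induct)
  case (insert x F)
  then show ?case
    using bounded_measurable_add[of G "f x" "\<lambda>w. \<Sum>i\<in>F. f i w"] by simp
qed (simp_all add: bounded_measurable_const)

lemma bounded_measurable_inner:
  assumes "bounded_measurable G f" "bounded_measurable G g"
  shows "bounded_measurable G (\<lambda>w. f w \<bullet> g w)"
proof -
  obtain K L where K: "\<And>w. norm (f w) \<le> K" and L: "\<And>w. norm (g w) \<le> L"
    using assms unfolding bounded_measurable_def by blast
  have "norm (f w \<bullet> g w) \<le> K * L" for w
  proof -
    have "norm (f w \<bullet> g w) \<le> norm (f w) * norm (g w)"
      by (simp add: Cauchy_Schwarz_ineq2)
    also have "\<dots> \<le> K * L"
      using K[of w] L[of w] by (intro mult_mono) (auto intro: order_trans[OF norm_ge_zero])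
    finally show ?thesis .
  qed
  then show ?thesis
    using assms by (intro bounded_measurableI borel_measurable_inner) (auto simp: bounded_measurable_def)
qed

lemma bounded_measurable_norm_square:
  "bounded_measurable G f \<Longrightarrow> bounded_measurable G (\<lambda>w. (norm (f w))\<^sup>2)"
  unfolding power2_norm_eq_inner by (rule bounded_measurable_inner)

lemma bounded_measurable_indicator:
  assumes "bounded_measurable G f" "g \<in> measurable G (count_space UNIV)"
  shows "bounded_measurable G (\<lambda>w. if Q (g w) then f w else 0)"
proof -
  obtain K where K: "\<And>w. norm (f w) \<le> K"
    using assms unfolding bounded_measurable_def by blast
  have "(\<lambda>w. if Q (g w) then f w else 0) \<in> borel_measurable G"
  proof (rule measurable_If)
    have "{w \<in> space G. Q (g w)} = g -` {x. Q x} \<inter> space G" by auto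
    then show "{w \<in> space G. Q (g w)} \<in> sets G"
      using measurable_sets[OF assms(2), of "{x. Q x}"] by simp
  qed (use assms in \<open>auto simp: bounded_measurable_def\<close>)
  moreover have "norm (if Q (g w) then f w else 0) \<le> K" for w
    using order_trans[OF norm_ge_zero K[of w]] K[of w] by simp
  ultimately show ?thesis by (rule bounded_measurableI)
qed

text \<open>A finite sum of pieces living on the events \<open>g w = i\<close>, which yields the
  measurability and a uniform bound together.\<close>

lemma bounded_measurable_select:
  fixes g :: "'w \<Rightarrow> 'n::finite"
  assumes f: "\<And>i. bounded_measurable G (f i)" and g: "g \<in> measurable G (count_space UNIV)"
  shows "bounded_measurable G (\<lambda>w. f (g w) w)"
proof -
  have "bounded_measurable G (\<lambda>w. \<Sum>i\<in>UNIV. if g w = i then f i w else 0)"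
    by (rule bounded_measurable_sum, rule bounded_measurable_indicator[OF f g])
  then show ?thesis by simp
qed

lemma (in finite_measure) bounded_measurable_integrable:
  "bounded_measurable M f \<Longrightarrow> integrable M f"
  unfolding bounded_measurable_def by (auto intro!: integrable_const_bound)

lemma bounded_measurable_subalgebra:
  "subalgebra M G \<Longrightarrow> bounded_measurable G f \<Longrightarrow> bounded_measurable M f"
  unfolding bounded_measurable_def using measurable_from_subalg by blast

text \<open>Variance is at most the second moment: the two sums differ by \<open>CARD('n)\<close>
  times the squared norm of the mean.\<close>

lemma sum_norm_square_centered_le:
  fixes u :: "'n::finite \<Rightarrow> 'b::real_inner"
  shows "(\<Sum>i\<in>UNIV. (norm (u i - (1 / real CARD('n)) *\<^sub>R (\<Sum>j\<in>UNIV. u j)))\<^sup>2) \<le> (\<Sum>i\<in>UNIV. (norm (u i))\<^sup>2)"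
proof -
  define m where "m = (1 / real CARD('n)) *\<^sub>R (\<Sum>j\<in>UNIV. u j)"
  have m: "(\<Sum>j\<in>UNIV. u j) = real CARD('n) *\<^sub>R m" by (simp add: m_def)
  have "(\<Sum>i\<in>UNIV. (norm (u i - m))\<^sup>2) = (\<Sum>i\<in>UNIV. (norm (u i))\<^sup>2 - 2 * (u i \<bullet> m) + m \<bullet> m)"
    by (intro sum.cong) (auto simp: power2_norm_eq_inner algebra_simps inner_commute)
  also have "\<dots> = (\<Sum>i\<in>UNIV. (norm (u i))\<^sup>2) - 2 * ((\<Sum>i\<in>UNIV. u i) \<bullet> m) + real CARD('n) * (m \<bullet> m)"
    by (simp add: sum.distrib sum_subtractf inner_sum_left sum_distrib_left)
  also have "\<dots> = (\<Sum>i\<in>UNIV. (norm (u i))\<^sup>2) - real CARD('n) * (m \<bullet> m)"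
    by (simp add: m)
  also have "\<dots> \<le> (\<Sum>i\<in>UNIV. (norm (u i))\<^sup>2)" by simp
  finally show ?thesis by (simp add: m_def)
qed

lemma (in isgd_measurable) qdelta_pos:
  assumes "C > 0"
  shows "qdelta (nbits P) (qsize P C s) > 0"
proof -
  have "(1::real) < 2 ^ nbits P"
    using problem by (intro one_less_power) (auto simp: isgd_problem_def)
  moreover have "qsize P C s > 0"
    using problem assms by (simp add: isgd_problem_def qsize_def)
  ultimately show ?thesis by (simp add: qdelta_def)
qed

section \<open>Integrating out one source of randomness\<close>

locale isgd_prob = prob_space M
  for M :: "'w measure" +
  fixes P :: "('n::finite, 'p::finite) isgd"
    and \<nu> :: "'w \<Rightarrow> ('n, 'p) dither \<Rightarrow> real"
    and nd :: "'w \<Rightarrow> nat \<Rightarrow> nat \<Rightarrow> 'n"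
  assumes problem: "isgd_problem P"
    and randomness: "isgd_randomness P M \<nu> nd"
begin

text \<open>Used in place of a filtration: it contains every past that does not involve
  \<open>\<kappa>\<close>, so one independence statement serves all dithers and all node
  draws.\<close>

definition others :: "(nat \<times> nat) + ('n, 'p) dither \<Rightarrow> 'w measure" where
  "others \<kappa> = sigma (space M) (\<Union>\<kappa>'\<in>sources P - {\<kappa>}. source_events M \<nu> nd \<kappa>')"

lemma indep_sources: "indep_sets (source_events M \<nu> nd) (sources P)"
  using randomness by (simp add: isgd_randomness_def sources_def)

lemma source_events_subset: "\<kappa> \<in> sources P \<Longrightarrow> source_events M \<nu> nd \<kappa> \<subseteq> events"
  using indep_sources by (auto simp: indep_sets_def)

text \<open>Intersection stability is what carries independence from the generating families to the
  sigma-algebra \<open>others\<close>.\<close>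

lemma Int_stable_source_events: "Int_stable (source_events M \<nu> nd \<kappa>)"
proof (rule Int_stableI)
  fix a b
  assume ab: "a \<in> source_events M \<nu> nd \<kappa>" "b \<in> source_events M \<nu> nd \<kappa>"
  show "a \<inter> b \<in> source_events M \<nu> nd \<kappa>"
  proof (cases \<kappa>)
    case (Inl st)
    obtain A B where "a = (\<lambda>\<omega>. nd \<omega> (fst st) (snd st)) -` A \<inter> space M"
      "b = (\<lambda>\<omega>. nd \<omega> (fst st) (snd st)) -` B \<inter> space M"
      using ab unfolding Inl source_events.simps by blast
    then have "a \<inter> b = (\<lambda>\<omega>. nd \<omega> (fst st) (snd st)) -` (A \<inter> B) \<inter> space M" by blast
    then show ?thesis unfolding Inl source_events.simps by blast
  next
    case (Inr \<delta>)
    obtain A B where AB: "A \<in> sets borel" "B \<in> sets borel"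
      and "a = (\<lambda>\<omega>. \<nu> \<omega> \<delta>) -` A \<inter> space M" "b = (\<lambda>\<omega>. \<nu> \<omega> \<delta>) -` B \<inter> space M"
      using ab unfolding Inr source_events.simps by blast
    then have "a \<inter> b = (\<lambda>\<omega>. \<nu> \<omega> \<delta>) -` (A \<inter> B) \<inter> space M" by blast
    moreover have "A \<inter> B \<in> sets borel" using AB by (rule sets.Int)
    ultimately show ?thesis unfolding Inr source_events.simps by blast
  qed
qed

lemma sets_others:
  "sets (others \<kappa>) = sigma_sets (space M) (\<Union>\<kappa>'\<in>sources P - {\<kappa>}. source_events M \<nu> nd \<kappa>')"
  and space_others: "space (others \<kappa>) = space M"
proof -
  have "(\<Union>\<kappa>'\<in>sources P - {\<kappa>}. source_events M \<nu> nd \<kappa>') \<subseteq> Pow (space M)"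
    using source_events_subset sets.sets_into_space by blast
  then show "sets (others \<kappa>) = sigma_sets (space M) (\<Union>\<kappa>'\<in>sources P - {\<kappa>}. source_events M \<nu> nd \<kappa>')"
    "space (others \<kappa>) = space M"
    by (simp_all add: others_def sets_measure_of space_measure_of)
qed

lemma subalgebra_others: "subalgebra M (others \<kappa>)"
  unfolding subalgebra_def sets_others space_others
  using source_events_subset by (auto intro!: sets.sigma_sets_subset)

lemma prob_others_indep:
  assumes "\<kappa> \<in> sources P" "A \<in> sets (others \<kappa>)" "B \<in> source_events M \<nu> nd \<kappa>"
  shows "prob (A \<inter> B) = prob A * prob B"
proof -
  \<comment> \<open>The sources are split into two groups indexed by \<open>bool\<close>: all but
    \<open>\<kappa>\<close>, and \<open>\<kappa>\<close> alone.\<close>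
  let ?I = "\<lambda>b. if b then sources P - {\<kappa>} else {\<kappa>}"
  have "(\<Union>b\<in>UNIV. ?I b) = sources P"
    using assms(1) by (auto simp: UNIV_bool)
  then have "indep_sets (\<lambda>b. sigma_sets (space M) (\<Union>i\<in>?I b. source_events M \<nu> nd i)) UNIV"
    using indep_sources Int_stable_source_events
    by (intro indep_sets_collect_sigma) (auto simp: disjoint_family_on_def split: if_splits)
  from indep_setsD[OF this, of UNIV "case_bool A B"] assms(2,3)
  show ?thesis by (simp add: UNIV_bool sets_others ac_simps)
qed

lemma source_measurable_M: "\<kappa> \<in> sources P \<Longrightarrow> source_measurable M \<nu> nd \<kappa>"
  using randomness by (auto simp: sources_def isgd_randomness_def)

lemma source_measurable_others:
  assumes "\<kappa>' \<in> sources P" "\<kappa>' \<noteq> \<kappa>"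
  shows "source_measurable (others \<kappa>) \<nu> nd \<kappa>'"
proof -
  have sub: "source_events M \<nu> nd \<kappa>' \<subseteq> sets (others \<kappa>)"
    unfolding sets_others using assms by (auto intro: sigma_sets.Basic)
  show ?thesis
  proof (cases \<kappa>')
    case (Inl st)
    then show ?thesis using sub by (auto simp: measurable_def space_others)
  next
    case (Inr \<delta>)
    then show ?thesis using sub by (auto simp: measurable_def space_others)
  qed
qed

sublocale isgd_measurable P M \<nu> nd
  by unfold_locales (rule problem)

sublocale oth: isgd_measurable P "others \<kappa>" \<nu> nd for \<kappa>
  by unfold_locales (rule problem)

lemma past_measurable_M: "past_measurable s t"
  by (simp add: past_measurable_def source_measurable_M)

text \<open>Here time order becomes independence: every source preceding \<open>(s, t)\<close>
  differs from \<open>\<kappa>\<close> and so stays measurable when \<open>\<kappa>\<close> is left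
  out.\<close>

lemma past_measurable_others: "\<not> before s t \<kappa> \<Longrightarrow> oth.past_measurable \<kappa> s t"
  unfolding oth.past_measurable_def by (auto intro: source_measurable_others)

lemma qdelta_dither_pos: "qdelta (nbits P) (dither_size P \<delta>) > 0"
  using problem qdelta_pos by (cases \<delta>) (auto simp: isgd_problem_def)

text \<open>With all other sources frozen, the input, the midpoint and the weight \<open>Z\<close>
  are constants, and the remaining integral is the mean-zero error of a uniform dither. Only the
  weight has to be bounded; input and midpoint need only be measurable.\<close>

lemma expectation_dquant_error:
  assumes \<delta>: "\<delta> \<in> dithers P"
    and Z: "bounded_measurable (others (Inr \<delta>)) Z"
    and m: "m \<in> borel_measurable (others (Inr \<delta>))"
    and z: "z \<in> borel_measurable (others (Inr \<delta>))"
  shows "(\<integral>\<omega>. Z \<omega> * (dquant (nbits P) (dither_size P \<delta>) (m \<omega>) (\<nu> \<omega> \<delta>) (z \<omega>) - z \<omega>) \<partial>M) = 0"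
proof -
  let ?U = "dither_size P \<delta>" and ?n = "nbits P"
  define f where "f = (\<lambda>(\<omega>, v). Z \<omega> * (dquant ?n ?U (m \<omega>) v (z \<omega>) - z \<omega>))"
  obtain K where K: "\<And>\<omega>. \<bar>Z \<omega>\<bar> \<le> K" using Z by (auto simp: bounded_measurable_def)
  have meas: "(\<lambda>\<omega>. \<nu> \<omega> \<delta>) \<in> borel_measurable M"
    and distr: "distr M borel (\<lambda>\<omega>. \<nu> \<omega> \<delta>) =
      uniform_measure lborel {- qdelta ?n ?U / 2 <..< qdelta ?n ?U / 2}"
    using randomness \<delta> by (auto simp: isgd_randomness_def)
  have "(\<integral>\<omega>. f (\<omega>, \<nu> \<omega> \<delta>) \<partial>M) = (\<integral>\<omega>. (\<integral>v. f (\<omega>, v) \<partial>distr M borel (\<lambda>\<omega>. \<nu> \<omega> \<delta>)) \<partial>M)"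
  proof (rule expectation_freezing[OF subalgebra_others meas])
    fix A B
    assume "A \<in> sets (others (Inr \<delta>))" "B \<in> sets (borel :: real measure)"
    moreover from this have "(\<lambda>\<omega>. \<nu> \<omega> \<delta>) -` B \<inter> space M \<in> source_events M \<nu> nd (Inr \<delta>)"
      by (simp, intro exI[of _ B]) simp
    moreover have "Inr \<delta> \<in> sources P" using \<delta> by (simp add: sources_def)
    ultimately show "prob (A \<inter> ((\<lambda>\<omega>. \<nu> \<omega> \<delta>) -` B \<inter> space M)) =
        prob A * prob ((\<lambda>\<omega>. \<nu> \<omega> \<delta>) -` B \<inter> space M)"
      by (intro prob_others_indep)
  next
    note [measurable] = m z bounded_measurableD[OF Z]
    show "f \<in> borel_measurable (others (Inr \<delta>) \<Otimes>\<^sub>M borel)"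
      unfolding f_def by measurable
  next
    fix \<omega> v
    show "\<bar>f (\<omega>, v)\<bar> \<le> K * (qdelta ?n ?U / 2)"
      unfolding f_def case_prod_conv abs_mult
      by (intro mult_mono K dquant_error_bound qdelta_dither_pos abs_ge_zero
          order_trans[OF abs_ge_zero K])
  qed
  also have "\<dots> = (\<integral>\<omega>. 0 \<partial>M)"
    unfolding distr f_def case_prod_conv integral_mult_right_zero
      integral_dquant_error[OF qdelta_dither_pos] by simp
  finally show ?thesis by (simp add: f_def)
qed

text \<open>Freezing with the drawn node as the independent variable; its uniform law turns the
  selected value into an average over nodes.\<close>

lemma expectation_drawn_node:
  fixes f :: "'n \<Rightarrow> 'w \<Rightarrow> real"
  assumes t: "t < inner_len P"
    and f: "\<And>i. bounded_measurable (others (Inl (s, t))) (f i)"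
  shows "(\<integral>\<omega>. f (nd \<omega> s t) \<omega> \<partial>M) = (\<integral>\<omega>. (1 / real CARD('n)) * (\<Sum>i\<in>UNIV. f i \<omega>) \<partial>M)"
proof -
  have meas: "(\<lambda>\<omega>. nd \<omega> s t) \<in> measurable M (count_space UNIV)"
    and distr: "distr M (count_space UNIV) (\<lambda>\<omega>. nd \<omega> s t) = uniform_count_measure UNIV"
    using randomness t by (auto simp: isgd_randomness_def)
  obtain K where K: "\<And>i \<omega>. \<bar>f i \<omega>\<bar> \<le> K i"
    using f unfolding bounded_measurable_def real_norm_def by metis
  define g where "g = (\<lambda>p. f (snd p) (fst p))"
  have "(\<integral>\<omega>. g (\<omega>, nd \<omega> s t) \<partial>M) =
      (\<integral>\<omega>. (\<integral>i. g (\<omega>, i) \<partial>distr M (count_space UNIV) (\<lambda>\<omega>. nd \<omega> s t)) \<partial>M)"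
  proof (rule expectation_freezing[OF subalgebra_others meas])
    fix A and B :: "'n set"
    assume "A \<in> sets (others (Inl (s, t)))"
    moreover have "(\<lambda>\<omega>. nd \<omega> s t) -` B \<inter> space M \<in> source_events M \<nu> nd (Inl (s, t))"
      by (simp, intro exI[of _ B]) simp
    moreover have "Inl (s, t) \<in> sources P" using t by (simp add: sources_def)
    ultimately show "prob (A \<inter> ((\<lambda>\<omega>. nd \<omega> s t) -` B \<inter> space M)) =
        prob A * prob ((\<lambda>\<omega>. nd \<omega> s t) -` B \<inter> space M)"
      by (intro prob_others_indep)
  next
    show "g \<in> borel_measurable (others (Inl (s, t)) \<Otimes>\<^sub>M count_space UNIV)"
      unfolding g_def
    proof (rule measurable_compose_countable)
      show "(\<lambda>p. f i (fst p)) \<in> borel_measurable (others (Inl (s, t)) \<Otimes>\<^sub>M count_space UNIV)" for i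
        using bounded_measurableD[OF f] by (rule measurable_compose[OF measurable_fst])
    qed (rule measurable_snd)
  next
    fix \<omega> i
    have "\<bar>f i \<omega>\<bar> \<le> K i" by (rule K)
    also have "\<dots> \<le> (\<Sum>j\<in>UNIV. \<bar>K j\<bar>)"
      using member_le_sum[of i UNIV "\<lambda>j. \<bar>K j\<bar>"] by simp
    finally show "\<bar>g (\<omega>, i)\<bar> \<le> (\<Sum>j\<in>UNIV. \<bar>K j\<bar>)" by (simp add: g_def)
  qed
  then show ?thesis
    by (simp add: g_def distr integral_uniform_count_measure)
qed

text \<open>Averaging over the draw turns both sides into sums over all nodes, where the variance
  inequality holds pointwise. This needs a family \<open>u\<close> that does not itself depend on
  the draw.\<close>

lemma expectation_centered_le:
  fixes u :: "'n \<Rightarrow> 'w \<Rightarrow> 'b::euclidean_space"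
  assumes t: "t < inner_len P"
    and u: "\<And>i. bounded_measurable (others (Inl (s, t))) (u i)"
  shows "(\<integral>\<omega>. (norm (u (nd \<omega> s t) \<omega> - (1 / real CARD('n)) *\<^sub>R (\<Sum>j\<in>UNIV. u j \<omega>)))\<^sup>2 \<partial>M)
    \<le> (\<integral>\<omega>. (norm (u (nd \<omega> s t) \<omega>))\<^sup>2 \<partial>M)"
proof -
  let ?m = "\<lambda>\<omega>. (1 / real CARD('n)) *\<^sub>R (\<Sum>j\<in>UNIV. u j \<omega>)"
  have 1: "bounded_measurable (others (Inl (s, t))) (\<lambda>\<omega>. (norm (u i \<omega> - ?m \<omega>))\<^sup>2)" for i
    by (intro bounded_measurable_norm_square bounded_measurable_diff bounded_measurable_scaleR
        bounded_measurable_sum u)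
  have 2: "bounded_measurable (others (Inl (s, t))) (\<lambda>\<omega>. (norm (u i \<omega>))\<^sup>2)" for i
    by (intro bounded_measurable_norm_square u)
  have int: "integrable M (g i)" if "\<And>i. bounded_measurable (others (Inl (s, t))) (g i)"
    for g :: "'n \<Rightarrow> 'w \<Rightarrow> real" and i
    using that by (intro bounded_measurable_integrable bounded_measurable_subalgebra[OF subalgebra_others])
  show ?thesis
    unfolding expectation_drawn_node[OF t, of s "\<lambda>i \<omega>. (norm (u i \<omega> - ?m \<omega>))\<^sup>2", OF 1]
      expectation_drawn_node[OF t, of s "\<lambda>i \<omega>. (norm (u i \<omega>))\<^sup>2", OF 2]
    by (intro integral_mono integrable_mult_right Bochner_Integration.integrable_sum int 1 2
        mult_left_mono sum_norm_square_centered_le) auto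
qed

end

section \<open>The quantization errors\<close>

definition grad_diff :: "('n::finite, 'p::finite) isgd \<Rightarrow> 'n \<Rightarrow> real^'p \<Rightarrow> real^'p \<Rightarrow> real^'p" where
  "grad_diff P i u w = gradl P i (Amat P i *v u) - gradl P i (Amat P i *v w)"

lemma gradl_in_coord_space:
  assumes "isgd_problem P"
  shows "gradl P i (Amat P i *v u) \<in> coord_space (nbh_coords P i)"
proof -
  have "\<forall>i. \<forall>z\<in>coord_space (nbh_coords P i). gradl P i z \<in> coord_space (nbh_coords P i)"
    using assms unfolding isgd_problem_def by blast
  then show ?thesis using Amat_in_coord_space by blast
qed

lemma grad_diff_in_coord_space:
  assumes "isgd_problem P"
  shows "grad_diff P i u w \<in> coord_space (nbh_coords P i)"
  unfolding grad_diff_def by (intro coord_space_diff gradl_in_coord_space[OF assms])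

text \<open>The constant parts of the affine gradients cancel. The matrices depend on neither
  argument, so expectations can pass through them.\<close>

lemma grad_diff_linear:
  assumes "isgd_problem P"
  obtains H where "\<And>i u w. grad_diff P i u w = H i *v (Amat P i *v (u - w))"
proof -
  have "\<forall>i. \<exists>H h. \<forall>z \<in> coord_space (nbh_coords P i). gradl P i z = H *v z + h"
    using assms by (simp add: isgd_problem_def)
  then obtain H h where "\<And>i z. z \<in> coord_space (nbh_coords P i) \<Longrightarrow> gradl P i z = H i *v z + h i"
    by metis
  then have "grad_diff P i u w = H i *v (Amat P i *v (u - w))" for i u w
    using Amat_in_coord_space[of P i]
    by (simp add: grad_diff_def matrix_vector_mult_diff_distrib)
  then show thesis by (rule that)
qed

lemma norm_square_vec: "(norm x)\<^sup>2 = (\<Sum>k\<in>UNIV. (x $ k)\<^sup>2)" for x :: "real^'p::finite"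
  unfolding power2_norm_eq_inner inner_vec_def by (simp add: power2_eq_square)

text \<open>Each coordinate has one owner, so the squared norm splits over blocks and
  \<open>Amat P i\<close> keeps those owned in the neighborhood.\<close>

lemma norm_Amat_conc_diff_square:
  assumes "supported_blocks P y" "supported_blocks P y'"
  shows "(norm (Amat P i *v (conc y - conc y')))\<^sup>2 = (\<Sum>j\<in>nbh P i. (norm (y j - y' j))\<^sup>2)"
proof -
  have "(norm (y j - y' j))\<^sup>2 = (\<Sum>k\<in>UNIV. if owner P k = j then ((conc y - conc y') $ k)\<^sup>2 else 0)" for j
    unfolding norm_square_vec using assms
    by (intro sum.cong)
      (auto simp: conc_nth supported_blocks_def coord_space_def own_coords_def)
  then have "(\<Sum>j\<in>nbh P i. (norm (y j - y' j))\<^sup>2) =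
      (\<Sum>k\<in>UNIV. \<Sum>j\<in>nbh P i. if owner P k = j then ((conc y - conc y') $ k)\<^sup>2 else 0)"
    by (simp add: sum.swap[of _ UNIV])
  also have "\<dots> = (norm (Amat P i *v (conc y - conc y')))\<^sup>2"
    unfolding norm_square_vec
    by (intro sum.cong) (auto simp: Amat_mult_nth mem_nbh_coords)
  finally show ?thesis ..
qed

lemma norm_grad_diff_square_le:
  assumes "isgd_problem P" "supported_blocks P y" "supported_blocks P y'"
  shows "(norm (grad_diff P i (conc y) (conc y')))\<^sup>2
    \<le> (Max (range (lipc P)))\<^sup>2 * (\<Sum>j\<in>nbh P i. (norm (y j - y' j))\<^sup>2)"
proof -
  have L: "(lipc P i)-lipschitz_on (coord_space (nbh_coords P i)) (gradl P i)"
    using assms(1) by (simp add: isgd_problem_def)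
  have "norm (grad_diff P i (conc y) (conc y')) \<le> lipc P i * norm (Amat P i *v (conc y - conc y'))"
    using lipschitz_onD[OF L Amat_in_coord_space Amat_in_coord_space]
    by (simp add: grad_diff_def dist_norm matrix_vector_mult_diff_distrib)
  also have "\<dots> \<le> Max (range (lipc P)) * norm (Amat P i *v (conc y - conc y'))"
    by (intro mult_right_mono) auto
  finally show ?thesis
    unfolding norm_Amat_conc_diff_square[OF assms(2,3), symmetric] power_mult_distrib[symmetric]
    by (rule power_mono) simp
qed

lemma conc_diff: "conc y - conc y' = (\<Sum>i\<in>UNIV. y i - y' i)"
  by (simp add: conc_def sum_subtractf)

lemma inner_matrix_vector_mult:
  "(A *v x) \<bullet> y = x \<bullet> (transpose A *v y)" for A :: "real^'p::finite^'q::finite"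
  by (metis dot_lmul_matrix inner_commute transpose_matrix_vector)

lemma grads_in_coord_space:
  "isgd_problem P \<Longrightarrow> grads P y i \<in> coord_space (nbh_coords P i)"
  unfolding grads_def by (rule gradl_in_coord_space)

text \<open>Reduces a coordinate to one scalar quantizer error. Its dither is indexed by the drawn
  node, hence itself randomly selected.\<close>

lemma err_d_nth:
  assumes "isgd_problem P"
  shows "err_d P \<nu> nd s t $ k =
    (if k \<in> nbh_coords P (nd s t)
     then dquant (nbits P) (qsize P (Cd P) s) (ghat P \<nu> nd s (nd s t) $ k)
        (\<nu> (DD s t (nd s t) k)) (grads P (xinhat P \<nu> nd s t) (nd s t) $ k)
        - grads P (xinhat P \<nu> nd s t) (nd s t) $ k
     else 0)"
  using grads_in_coord_space[OF assms]
  by (auto simp: err_d_def ginhat_def quantD_def vquant_def coord_space_def)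

lemma err_c_nth:
  "(conc (xinhat P \<nu> nd s t) - conc (xin P \<nu> nd s t)) $ k =
    dquant (nbits P) (qsize P (Cc P) s) (xthat P \<nu> nd s (owner P k) $ k)
      (\<nu> (DC s t k)) (xin P \<nu> nd s t (owner P k) $ k)
    - xin P \<nu> nd s t (owner P k) $ k"
  by (simp add: conc_nth[OF supported_blocks_xin] conc_nth[OF supported_blocks_xinhat])
    (simp add: xinhat_def quantC_def vquant_def own_coords_def)

text \<open>Every summand already lies in the coordinate subspace of its neighborhood, so the
  transposed selection matrices act as the identity; the rest is regrouping.\<close>

lemma svrg_err_eq:
  fixes P :: "('n::finite, 'p::finite) isgd"
  assumes "isgd_problem P"
  shows "svrg_err P \<nu> nd s t =
    (grad_diff P (nd s t) (conc (xinhat P \<nu> nd s t)) (conc (xin P \<nu> nd s t))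
     - ((grad_diff P (nd s t) (conc (xthat P \<nu> nd s)) (conc (xtil P \<nu> nd s))
         - (1 / real CARD('n)) *\<^sub>R (\<Sum>i\<in>UNIV. grad_diff P i (conc (xthat P \<nu> nd s)) (conc (xtil P \<nu> nd s))))
        + (err_b P \<nu> nd s (nd s t) - (1 / real CARD('n)) *\<^sub>R (\<Sum>i\<in>UNIV. err_b P \<nu> nd s i))))
    + err_d P \<nu> nd s t"
proof -
  have b: "Amat P i *v err_b P \<nu> nd s i = err_b P \<nu> nd s i" for i
    by (intro Amat_mult_id)
      (simp add: err_b_def ghat_def quantB_def coord_space_diff vquant_in_coord_space
        grads_in_coord_space[OF assms])
  have d: "Amat P (nd s t) *v err_d P \<nu> nd s t = err_d P \<nu> nd s t"
    by (intro Amat_mult_id) (simp add: coord_space_def err_d_nth[OF assms])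
  have g: "Amat P i *v grad_diff P i u w = grad_diff P i u w" for i u w
    by (intro Amat_mult_id grad_diff_in_coord_space[OF assms])
  show ?thesis
    unfolding svrg_err_def Let_def transpose_Amat grad_diff_def[symmetric] b d g
    by (simp add: algebra_simps)
qed

section \<open>Boundedness and measurability of the error terms\<close>

context isgd_measurable
begin

lemma diff_bounded_measurable:
  assumes "blocks_measurable y" "blocks_measurable y'" "\<And>\<omega>. norm (y \<omega> i - y' \<omega> i) \<le> K"
  shows "bounded_measurable G (\<lambda>\<omega>. y \<omega> i - y' \<omega> i)"
proof (rule bounded_measurableI[OF borel_measurable_diff assms(3)])
  show "(\<lambda>\<omega>. y \<omega> i) \<in> borel_measurable G" "(\<lambda>\<omega>. y' \<omega> i) \<in> borel_measurable G"
    using assms(1,2) by (simp_all add: blocks_measurable_def)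
qed

lemma err_a_bounded_measurable:
  assumes "past_measurable s 0"
  shows "bounded_measurable G (\<lambda>\<omega>. err_a P (\<nu> \<omega>) (nd \<omega>) s i)"
  unfolding err_a_def
proof (rule diff_bounded_measurable[OF outer_state_measurable(2,1)[OF assms]])
  fix \<omega>
  have "qdelta (nbits P) (qsize P (Ca P) s) > 0"
    using problem by (intro qdelta_pos) (simp add: isgd_problem_def)
  from vquant_error_bound[OF this]
  show "norm (xthat P (\<nu> \<omega>) (nd \<omega>) s i - xtil P (\<nu> \<omega>) (nd \<omega>) s i)
      \<le> real CARD('p) * (qdelta (nbits P) (qsize P (Ca P) s) / 2)"
    using supported_blocks_xtil unfolding xthat_def quantA_def supported_blocks_def by blast
qed

lemma err_b_bounded_measurable:
  assumes "past_measurable s 0"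
  shows "bounded_measurable G (\<lambda>\<omega>. err_b P (\<nu> \<omega>) (nd \<omega>) s i)"
  unfolding err_b_def
proof (rule diff_bounded_measurable[OF outer_state_measurable(3)[OF assms]
      grads_measurable[OF outer_state_measurable(2)[OF assms]]])
  fix \<omega>
  have "qdelta (nbits P) (qsize P (Cb P) s) > 0"
    using problem by (intro qdelta_pos) (simp add: isgd_problem_def)
  from vquant_error_bound[OF this grads_in_coord_space[OF problem]]
  show "norm (ghat P (\<nu> \<omega>) (nd \<omega>) s i - grads P (xthat P (\<nu> \<omega>) (nd \<omega>) s) i)
      \<le> real CARD('p) * (qdelta (nbits P) (qsize P (Cb P) s) / 2)"
    unfolding ghat_def quantB_def by blast
qed

lemma err_c_bounded_measurable:
  assumes "past_measurable s t" "t \<le> inner_len P" "\<And>k. source_measurable G \<nu> nd (Inr (DC s t k))"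
  shows "bounded_measurable G (\<lambda>\<omega>. err_c P (\<nu> \<omega>) (nd \<omega>) s t i)"
  unfolding err_c_def
proof (rule diff_bounded_measurable[OF xinhat_measurable xin_measurable])
  fix \<omega>
  have "qdelta (nbits P) (qsize P (Cc P) s) > 0"
    using problem by (intro qdelta_pos) (simp add: isgd_problem_def)
  from vquant_error_bound[OF this]
  show "norm (xinhat P (\<nu> \<omega>) (nd \<omega>) s t i - xin P (\<nu> \<omega>) (nd \<omega>) s t i)
      \<le> real CARD('p) * (qdelta (nbits P) (qsize P (Cc P) s) / 2)"
    using supported_blocks_xin unfolding xinhat_def quantC_def supported_blocks_def by blast
qed (use assms outer_state_measurable[OF past_measurable_0D[OF assms(1)]] xin_measurable in auto)

lemma err_d_bounded_measurable:
  assumes "past_measurable s t" "t \<le> inner_len P" "source_measurable G \<nu> nd (Inl (s, t))"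
    and "\<And>k. source_measurable G \<nu> nd (Inr (DC s t k))"
    and "\<And>l k. k \<in> nbh_coords P l \<Longrightarrow> source_measurable G \<nu> nd (Inr (DD s t l k))"
  shows "bounded_measurable G (\<lambda>\<omega>. err_d P (\<nu> \<omega>) (nd \<omega>) s t)"
proof (rule bounded_measurableI)
  note outer = outer_state_measurable[OF past_measurable_0D[OF assms(1)]]
  have xh: "blocks_measurable (\<lambda>\<omega>. xinhat P (\<nu> \<omega>) (nd \<omega>) s t)"
    using assms outer xin_measurable by (intro xinhat_measurable) auto
  have "(\<lambda>\<omega>. ginhat P (\<nu> \<omega>) (nd \<omega>) s t) \<in> borel_measurable G"
    using assms outer xh by (intro ginhat_measurable) auto
  moreover have "(\<lambda>\<omega>. grads P (xinhat P (\<nu> \<omega>) (nd \<omega>) s t) (nd \<omega> s t)) \<in> borel_measurable G"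
  proof -
    have "(\<lambda>\<omega>. grads P (xinhat P (\<nu> \<omega>) (nd \<omega>) s t) i) \<in> borel_measurable G" for i
      using grads_measurable[OF xh] by (simp add: blocks_measurable_def)
    moreover have "(\<lambda>\<omega>. nd \<omega> s t) \<in> measurable G (count_space UNIV)" using assms(3) by simp
    ultimately show ?thesis by (rule measurable_compose_countable)
  qed
  ultimately show "(\<lambda>\<omega>. err_d P (\<nu> \<omega>) (nd \<omega>) s t) \<in> borel_measurable G"
    unfolding err_d_def by (rule borel_measurable_diff)
next
  fix \<omega>
  have "qdelta (nbits P) (qsize P (Cd P) s) > 0"
    using problem by (intro qdelta_pos) (simp add: isgd_problem_def)
  from vquant_error_bound[OF this grads_in_coord_space[OF problem]]
  show "norm (err_d P (\<nu> \<omega>) (nd \<omega>) s t) \<le> real CARD('p) * (qdelta (nbits P) (qsize P (Cd P) s) / 2)"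
    unfolding err_d_def ginhat_def quantD_def by blast
qed

text \<open>The two arguments may be unbounded separately; by linearity the gradient difference
  depends only on their bounded difference.\<close>

lemma grad_diff_bounded_measurable:
  assumes "\<And>i. bounded_measurable G (\<lambda>\<omega>. y \<omega> i - y' \<omega> i)"
  shows "bounded_measurable G (\<lambda>\<omega>. grad_diff P i (conc (y \<omega>)) (conc (y' \<omega>)))"
proof -
  obtain H where H: "\<And>i u w. grad_diff P i u w = H i *v (Amat P i *v (u - w))"
    using grad_diff_linear[OF problem] by blast
  show ?thesis
    unfolding H conc_diff
    by (intro bounded_measurable_matrix_vector_mult bounded_measurable_sum assms)
qed

lemma grad_diff_outer_bounded_measurable:
  assumes "past_measurable s 0"
  shows "bounded_measurable G
    (\<lambda>\<omega>. grad_diff P i (conc (xthat P (\<nu> \<omega>) (nd \<omega>) s)) (conc (xtil P (\<nu> \<omega>) (nd \<omega>) s)))"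
  using grad_diff_bounded_measurable[OF err_a_bounded_measurable[OF assms, unfolded err_a_def]] .

lemma grad_diff_inner_bounded_measurable:
  assumes "past_measurable s t" "t \<le> inner_len P" "\<And>k. source_measurable G \<nu> nd (Inr (DC s t k))"
  shows "bounded_measurable G
    (\<lambda>\<omega>. grad_diff P i (conc (xinhat P (\<nu> \<omega>) (nd \<omega>) s t)) (conc (xin P (\<nu> \<omega>) (nd \<omega>) s t)))"
  using grad_diff_bounded_measurable[OF err_c_bounded_measurable[OF assms, unfolded err_c_def]] .

end

section \<open>Orthogonality relations for the inner quantization errors\<close>

context isgd_prob
begin

text \<open>The inner product is split over coordinates \<open>k\<close> and over the events that
  node \<open>i\<close> is drawn. On such an event the dither involved is the fixed one
  \<open>DD s t i k\<close>, and the indicator of the event joins the weight.\<close>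

lemma expectation_inner_err_d:
  assumes t: "t < inner_len P"
    and W: "\<And>i k. k \<in> nbh_coords P i \<Longrightarrow> bounded_measurable (others (Inr (DD s t i k))) W"
    and WM: "bounded_measurable M W"
  shows "(\<integral>\<omega>. W \<omega> \<bullet> err_d P (\<nu> \<omega>) (nd \<omega>) s t \<partial>M) = 0"
proof -
  let ?D = "\<lambda>\<omega>. err_d P (\<nu> \<omega>) (nd \<omega>) s t"
  let ?F = "\<lambda>i k \<omega>. if nd \<omega> s t = i then W \<omega> $ k * ?D \<omega> $ k else 0"
  have src: "Inl (s, t) \<in> sources P" "\<And>k. Inr (DC s t k) \<in> sources P"
    "\<And>i k. k \<in> nbh_coords P i \<Longrightarrow> Inr (DD s t i k) \<in> sources P"
    using t by (auto simp: sources_def dithers_def)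
  have D: "bounded_measurable M ?D"
    using t src by (intro err_d_bounded_measurable past_measurable_M source_measurable_M) auto
  have nd: "(\<lambda>\<omega>. nd \<omega> s t) \<in> measurable M (count_space UNIV)"
    using source_measurable_M[OF src(1)] by simp
  have int: "integrable M (?F i k)" for i k
    using bounded_measurable_inner[OF bounded_measurable_nth[OF WM] bounded_measurable_nth[OF D], of k k]
    by (intro bounded_measurable_integrable bounded_measurable_indicator[OF _ nd, of _ "\<lambda>j. j = i"])
      simp
  have zero: "(\<integral>\<omega>. ?F i k \<omega> \<partial>M) = 0" for i k
  proof (cases "k \<in> nbh_coords P i")
    case False
    \<comment> \<open>When \<open>i\<close> is drawn, \<open>err_d\<close> vanishes in this
      coordinate, for which no dither is supplied.\<close>
    then have "?F i k = (\<lambda>\<omega>. 0)" by (auto simp: fun_eq_iff err_d_nth[OF problem])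
    then show ?thesis by simp
  next
    case True
    let ?\<kappa> = "Inr (DD s t i k)"
    have \<delta>: "DD s t i k \<in> dithers P" using True t by (auto simp: dithers_def)
    have past: "oth.past_measurable ?\<kappa> s t" by (rule past_measurable_others) simp
    have outer: "oth.blocks_measurable ?\<kappa> (\<lambda>\<omega>. xthat P (\<nu> \<omega>) (nd \<omega>) s)"
        "oth.blocks_measurable ?\<kappa> (\<lambda>\<omega>. ghat P (\<nu> \<omega>) (nd \<omega>) s)"
      by (rule oth.outer_state_measurable[OF oth.past_measurable_0D[OF past]])+
    have xh: "oth.blocks_measurable ?\<kappa> (\<lambda>\<omega>. xinhat P (\<nu> \<omega>) (nd \<omega>) s t)"
      using t src(2) by (intro oth.xinhat_measurable outer oth.xin_measurable past
          source_measurable_others) auto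
    have nd': "(\<lambda>\<omega>. nd \<omega> s t) \<in> measurable (others ?\<kappa>) (count_space UNIV)"
      using source_measurable_others[OF src(1), of ?\<kappa>] by simp
    have "?F i k \<omega> = (if nd \<omega> s t = i then W \<omega> $ k else 0) *
        (dquant (nbits P) (dither_size P (DD s t i k)) (ghat P (\<nu> \<omega>) (nd \<omega>) s i $ k)
          (\<nu> \<omega> (DD s t i k)) (grads P (xinhat P (\<nu> \<omega>) (nd \<omega>) s t) i $ k)
         - grads P (xinhat P (\<nu> \<omega>) (nd \<omega>) s t) i $ k)" for \<omega>
      using True by (simp add: err_d_nth[OF problem])
    then show ?thesis
      using outer(2) oth.grads_measurable[OF xh]
      by (simp only:, intro expectation_dquant_error \<delta> borel_measurable_vec_nth
          bounded_measurable_indicator[OF _ nd', of _ "\<lambda>j. j = i"] bounded_measurable_nth W[OF True])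
        (simp_all add: oth.blocks_measurable_def)
  qed
  have "W \<omega> \<bullet> ?D \<omega> = (\<Sum>k\<in>UNIV. \<Sum>i\<in>UNIV. ?F i k \<omega>)" for \<omega>
    by (simp add: inner_vec_def)
  then have "(\<integral>\<omega>. W \<omega> \<bullet> ?D \<omega> \<partial>M) = (\<Sum>k\<in>UNIV. \<Sum>i\<in>UNIV. \<integral>\<omega>. ?F i k \<omega> \<partial>M)"
    using int by (simp only: Bochner_Integration.integral_sum Bochner_Integration.integrable_sum)
  then show ?thesis by (simp only: zero sum.neutral_const)
qed

text \<open>The adjoint moves the linear map from the quantization error to the weight
  \<open>V\<close>. Each coordinate is then one scalar error times a bounded weight free of its
  dither. The dithers \<open>DC\<close> do not depend on the drawn node, so the draw can stay inside
  \<open>V\<close>.\<close>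

lemma expectation_inner_grad_diff:
  assumes t: "t < inner_len P"
    and Y: "\<And>k. bounded_measurable (others (Inr (DC s t k))) Y"
    and YM: "bounded_measurable M Y"
  shows "(\<integral>\<omega>. grad_diff P (nd \<omega> s t) (conc (xinhat P (\<nu> \<omega>) (nd \<omega>) s t))
      (conc (xin P (\<nu> \<omega>) (nd \<omega>) s t)) \<bullet> Y \<omega> \<partial>M) = 0"
proof -
  obtain H where H: "\<And>i u w. grad_diff P i u w = H i *v (Amat P i *v (u - w))"
    using grad_diff_linear[OF problem] by blast
  define V where "V = (\<lambda>\<omega>. Amat P (nd \<omega> s t) *v (transpose (H (nd \<omega> s t)) *v Y \<omega>))"
  let ?c = "\<lambda>\<omega>. conc (xinhat P (\<nu> \<omega>) (nd \<omega>) s t) - conc (xin P (\<nu> \<omega>) (nd \<omega>) s t)"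
  have src: "Inl (s, t) \<in> sources P" "\<And>k. Inr (DC s t k) \<in> sources P"
    using t by (auto simp: sources_def dithers_def)
  have V: "bounded_measurable G' V"
    if "bounded_measurable G' Y" "source_measurable G' \<nu> nd (Inl (s, t))" for G'
  proof -
    have nd: "(\<lambda>\<omega>. nd \<omega> s t) \<in> measurable G' (count_space UNIV)" using that(2) by simp
    have "bounded_measurable G' (\<lambda>\<omega>. Amat P i *v (transpose (H i) *v Y \<omega>))" for i
      by (intro bounded_measurable_matrix_vector_mult that(1))
    from bounded_measurable_select[OF this nd] show ?thesis unfolding V_def .
  qed
  have c: "bounded_measurable M ?c"
    unfolding conc_diff using t src
    by (intro bounded_measurable_sum err_c_bounded_measurable[unfolded err_c_def] past_measurable_M
        source_measurable_M) auto
  have int: "integrable M (\<lambda>\<omega>. V \<omega> $ k * ?c \<omega> $ k)" for k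
    using bounded_measurable_inner[OF bounded_measurable_nth[OF V[OF YM source_measurable_M[OF src(1)]]]
        bounded_measurable_nth[OF c], of k k]
    by (intro bounded_measurable_integrable) simp
  have zero: "(\<integral>\<omega>. V \<omega> $ k * ?c \<omega> $ k \<partial>M) = 0" for k
  proof -
    let ?\<kappa> = "Inr (DC s t k)"
    have \<delta>: "DC s t k \<in> dithers P" using t by (auto simp: dithers_def)
    have past: "oth.past_measurable ?\<kappa> s t" by (rule past_measurable_others) simp
    have "bounded_measurable (others ?\<kappa>) V"
      using src(1) by (intro V Y source_measurable_others) auto
    moreover have "oth.blocks_measurable ?\<kappa> (\<lambda>\<omega>. xthat P (\<nu> \<omega>) (nd \<omega>) s)"
      by (rule oth.outer_state_measurable[OF oth.past_measurable_0D[OF past]])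
    moreover have "oth.blocks_measurable ?\<kappa> (\<lambda>\<omega>. xin P (\<nu> \<omega>) (nd \<omega>) s t)"
      using t past by (intro oth.xin_measurable) auto
    moreover have "V \<omega> $ k * ?c \<omega> $ k = V \<omega> $ k *
        (dquant (nbits P) (dither_size P (DC s t k)) (xthat P (\<nu> \<omega>) (nd \<omega>) s (owner P k) $ k)
          (\<nu> \<omega> (DC s t k)) (xin P (\<nu> \<omega>) (nd \<omega>) s t (owner P k) $ k)
         - xin P (\<nu> \<omega>) (nd \<omega>) s t (owner P k) $ k)" for \<omega>
      by (simp only: err_c_nth dither_size.simps)
    ultimately show ?thesis
      by (simp only:, intro expectation_dquant_error \<delta> borel_measurable_vec_nth bounded_measurable_nth)
        (simp_all add: oth.blocks_measurable_def)
  qed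
  have "grad_diff P (nd \<omega> s t) (conc (xinhat P (\<nu> \<omega>) (nd \<omega>) s t))
      (conc (xin P (\<nu> \<omega>) (nd \<omega>) s t)) \<bullet> Y \<omega> = (\<Sum>k\<in>UNIV. V \<omega> $ k * ?c \<omega> $ k)" for \<omega>
    unfolding H inner_matrix_vector_mult transpose_Amat V_def
    unfolding inner_vec_def inner_real_def by (intro sum.cong refl mult.commute)
  then have "(\<integral>\<omega>. grad_diff P (nd \<omega> s t) (conc (xinhat P (\<nu> \<omega>) (nd \<omega>) s t))
      (conc (xin P (\<nu> \<omega>) (nd \<omega>) s t)) \<bullet> Y \<omega> \<partial>M) = (\<Sum>k\<in>UNIV. \<integral>\<omega>. V \<omega> $ k * ?c \<omega> $ k \<partial>M)"
    using int by (simp only: Bochner_Integration.integral_sum)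
  then show ?thesis by (simp only: zero sum.neutral_const)
qed

end

section \<open>The second-moment estimate\<close>

context isgd_prob
begin

lemma expectation_svrg_err_le:
  assumes t: "t < inner_len P"
  shows "integrable M (\<lambda>\<omega>. (norm (svrg_err P (\<nu> \<omega>) (nd \<omega>) s t))\<^sup>2)" (is ?int)
    and "(\<integral>\<omega>. (norm (svrg_err P (\<nu> \<omega>) (nd \<omega>) s t))\<^sup>2 \<partial>M) \<le>
      (Max (range (lipc P)))\<^sup>2 * (\<integral>\<omega>. (\<Sum>j\<in>nbh P (nd \<omega> s t). (norm (err_c P (\<nu> \<omega>) (nd \<omega>) s t j))\<^sup>2) \<partial>M)
      + 2 * (Max (range (lipc P)))\<^sup>2 * (\<integral>\<omega>. (\<Sum>j\<in>nbh P (nd \<omega> s t). (norm (err_a P (\<nu> \<omega>) (nd \<omega>) s j))\<^sup>2) \<partial>M)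
      + (\<integral>\<omega>. (norm (err_d P (\<nu> \<omega>) (nd \<omega>) s t))\<^sup>2 \<partial>M)
      + 2 * (\<integral>\<omega>. (norm (err_b P (\<nu> \<omega>) (nd \<omega>) s (nd \<omega> s t)))\<^sup>2 \<partial>M)" (is ?le)
proof -
  let ?L2 = "(Max (range (lipc P)))\<^sup>2"
  have src: "Inl (s, t) \<in> sources P" "\<And>k. Inr (DC s t k) \<in> sources P"
    "\<And>i k. k \<in> nbh_coords P i \<Longrightarrow> Inr (DD s t i k) \<in> sources P"
    using t by (auto simp: sources_def dithers_def)
  define C where "C = (\<lambda>i \<omega>. grad_diff P i (conc (xinhat P (\<nu> \<omega>) (nd \<omega>) s t)) (conc (xin P (\<nu> \<omega>) (nd \<omega>) s t)))"
  define A where "A = (\<lambda>i \<omega>. grad_diff P i (conc (xthat P (\<nu> \<omega>) (nd \<omega>) s)) (conc (xtil P (\<nu> \<omega>) (nd \<omega>) s)))"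
  define B where "B = (\<lambda>i \<omega>. err_b P (\<nu> \<omega>) (nd \<omega>) s i)"
  define D where "D = (\<lambda>\<omega>. err_d P (\<nu> \<omega>) (nd \<omega>) s t)"
  define cen where "cen = (\<lambda>(u :: 'n \<Rightarrow> 'w \<Rightarrow> real^'p) i \<omega>. u i \<omega> - (1 / real CARD('n)) *\<^sub>R (\<Sum>j\<in>UNIV. u j \<omega>))"
  \<comment> \<open>Collects what is fixed before the inner loop, apart from the node
    selection.\<close>
  define Y where "Y = (\<lambda>\<omega>. cen A (nd \<omega> s t) \<omega> + cen B (nd \<omega> s t) \<omega>)"
  define W where "W = (\<lambda>\<omega>. C (nd \<omega> s t) \<omega> - Y \<omega>)"
  have e: "svrg_err P (\<nu> \<omega>) (nd \<omega>) s t = W \<omega> + D \<omega>" for \<omega>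
    unfolding svrg_err_eq[OF problem] W_def Y_def cen_def A_def B_def C_def D_def ..

  have cen: "bounded_measurable G (cen u i)" if "\<And>j. bounded_measurable G (u j)" for G u i
    unfolding cen_def
    by (intro bounded_measurable_diff bounded_measurable_scaleR bounded_measurable_sum that)
  \<comment> \<open>Stated for arbitrary \<open>G\<close> because it is applied to \<open>M\<close>
    and to sigma-algebras without one dither.\<close>
  have Y: "bounded_measurable G Y"
    if "isgd_measurable.past_measurable P G \<nu> nd s 0" "source_measurable G \<nu> nd (Inl (s, t))" for G
  proof -
    interpret G: isgd_measurable P G \<nu> nd by unfold_locales (rule problem)
    have nd: "(\<lambda>\<omega>. nd \<omega> s t) \<in> measurable G (count_space UNIV)" using that(2) by simp
    have "bounded_measurable G (A j)" "bounded_measurable G (B j)" for j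
      unfolding A_def B_def
      by (rule G.grad_diff_outer_bounded_measurable[OF that(1)] G.err_b_bounded_measurable[OF that(1)])+
    then show ?thesis
      unfolding Y_def by (intro bounded_measurable_add bounded_measurable_select[OF cen nd])
  qed
  have C: "bounded_measurable G (\<lambda>\<omega>. C (nd \<omega> s t) \<omega>)"
    if "isgd_measurable.past_measurable P G \<nu> nd s t" "source_measurable G \<nu> nd (Inl (s, t))"
      "\<And>k. source_measurable G \<nu> nd (Inr (DC s t k))" for G
  proof -
    interpret G: isgd_measurable P G \<nu> nd by unfold_locales (rule problem)
    have nd: "(\<lambda>\<omega>. nd \<omega> s t) \<in> measurable G (count_space UNIV)" using that(2) by simp
    have "bounded_measurable G (C j)" for j
      unfolding C_def using t by (intro G.grad_diff_inner_bounded_measurable that) simp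
    then show ?thesis by (rule bounded_measurable_select[OF _ nd])
  qed

  have ndM: "(\<lambda>\<omega>. nd \<omega> s t) \<in> measurable M (count_space UNIV)"
    using source_measurable_M[OF src(1)] by simp
  have AM: "bounded_measurable M (A j)" and BM: "bounded_measurable M (B j)" for j
    unfolding A_def B_def
    by (rule grad_diff_outer_bounded_measurable[OF past_measurable_M] err_b_bounded_measurable[OF past_measurable_M])+
  have YM: "bounded_measurable M Y"
    by (intro Y past_measurable_M source_measurable_M src)
  have CM: "bounded_measurable M (\<lambda>\<omega>. C (nd \<omega> s t) \<omega>)"
    by (intro C past_measurable_M source_measurable_M src)
  have WM: "bounded_measurable M W"
    unfolding W_def by (intro bounded_measurable_diff CM YM)
  have DM: "bounded_measurable M D"
    unfolding D_def using t
    by (intro err_d_bounded_measurable past_measurable_M source_measurable_M src) auto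
  have sel: "bounded_measurable M (\<lambda>\<omega>. u (nd \<omega> s t) \<omega>)" if "\<And>j. bounded_measurable M (u j)"
    for u :: "'n \<Rightarrow> 'w \<Rightarrow> 'b::euclidean_space"
    by (rule bounded_measurable_select[OF that ndM])
  have sq: "integrable M (\<lambda>\<omega>. (norm (u \<omega>))\<^sup>2)" if "bounded_measurable M u"
    for u :: "'w \<Rightarrow> real^'p"
    by (rule bounded_measurable_integrable[OF bounded_measurable_norm_square[OF that]])
  have inn: "integrable M (\<lambda>\<omega>. u \<omega> \<bullet> v \<omega>)" if "bounded_measurable M u" "bounded_measurable M v"
    for u v :: "'w \<Rightarrow> real^'p"
    by (rule bounded_measurable_integrable[OF bounded_measurable_inner[OF that]])

  show ?int unfolding e by (intro sq bounded_measurable_add WM DM)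

  \<comment> \<open>\<open>W\<close> involves the draw and the \<open>DC\<close> dithers of the
    current step, but none of its \<open>DD\<close> dithers.\<close>
  have WD: "(\<integral>\<omega>. W \<omega> \<bullet> D \<omega> \<partial>M) = 0"
    unfolding D_def
  proof (rule expectation_inner_err_d[OF t _ WM])
    fix i k
    let ?\<kappa> = "Inr (DD s t i k) :: (nat \<times> nat) + ('n, 'p) dither"
    have "oth.past_measurable ?\<kappa> s t" by (rule past_measurable_others) simp
    then show "bounded_measurable (others ?\<kappa>) W"
      unfolding W_def using src
      by (intro bounded_measurable_diff C Y source_measurable_others oth.past_measurable_0D) auto
  qed
  \<comment> \<open>\<open>Y\<close> involves the draw but none of the \<open>DC\<close> dithers of
    the current step.\<close>
  have CY: "(\<integral>\<omega>. C (nd \<omega> s t) \<omega> \<bullet> Y \<omega> \<partial>M) = 0"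
    unfolding C_def
  proof (rule expectation_inner_grad_diff[OF t _ YM])
    fix k
    let ?\<kappa> = "Inr (DC s t k) :: (nat \<times> nat) + ('n, 'p) dither"
    have "oth.past_measurable ?\<kappa> s 0" by (rule past_measurable_others) simp
    then show "bounded_measurable (others ?\<kappa>) Y"
      using src by (intro Y source_measurable_others) auto
  qed

  have sum_bm: "integrable M (\<lambda>\<omega>. \<Sum>j\<in>nbh P (nd \<omega> s t). (norm (u j \<omega>))\<^sup>2)"
    if "\<And>j. bounded_measurable M (u j)" for u :: "'n \<Rightarrow> 'w \<Rightarrow> real^'p"
  proof -
    have "bounded_measurable M (\<lambda>\<omega>. \<Sum>j\<in>nbh P i. (norm (u j \<omega>))\<^sup>2)" for i
      by (intro bounded_measurable_sum bounded_measurable_norm_square that)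
    from sel[OF this] show ?thesis by (rule bounded_measurable_integrable)
  qed

  have "(\<integral>\<omega>. (norm (svrg_err P (\<nu> \<omega>) (nd \<omega>) s t))\<^sup>2 \<partial>M) =
      (\<integral>\<omega>. (norm (W \<omega>))\<^sup>2 + 2 * (W \<omega> \<bullet> D \<omega>) + (norm (D \<omega>))\<^sup>2 \<partial>M)"
    unfolding e by (simp add: power2_norm_eq_inner inner_add_left inner_add_right inner_commute algebra_simps)
  also have "\<dots> = (\<integral>\<omega>. (norm (W \<omega>))\<^sup>2 \<partial>M) + (\<integral>\<omega>. (norm (D \<omega>))\<^sup>2 \<partial>M)"
    using sq[OF WM] sq[OF DM] inn[OF WM DM] WD by simp
  also have "(\<integral>\<omega>. (norm (W \<omega>))\<^sup>2 \<partial>M) =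
      (\<integral>\<omega>. (norm (C (nd \<omega> s t) \<omega>))\<^sup>2 - 2 * (C (nd \<omega> s t) \<omega> \<bullet> Y \<omega>) + (norm (Y \<omega>))\<^sup>2 \<partial>M)"
    unfolding W_def by (simp add: power2_norm_eq_inner inner_diff_left inner_diff_right inner_commute algebra_simps)
  also have "\<dots> = (\<integral>\<omega>. (norm (C (nd \<omega> s t) \<omega>))\<^sup>2 \<partial>M) + (\<integral>\<omega>. (norm (Y \<omega>))\<^sup>2 \<partial>M)"
    using sq[OF CM] sq[OF YM] inn[OF CM YM] CY by simp
  also have "(\<integral>\<omega>. (norm (C (nd \<omega> s t) \<omega>))\<^sup>2 \<partial>M) \<le>
      ?L2 * (\<integral>\<omega>. (\<Sum>j\<in>nbh P (nd \<omega> s t). (norm (err_c P (\<nu> \<omega>) (nd \<omega>) s t j))\<^sup>2) \<partial>M)"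
  proof -
    have c: "bounded_measurable M (\<lambda>\<omega>. err_c P (\<nu> \<omega>) (nd \<omega>) s t j)" for j
      using t by (intro err_c_bounded_measurable past_measurable_M source_measurable_M src) auto
    have "(norm (C (nd \<omega> s t) \<omega>))\<^sup>2 \<le>
        ?L2 * (\<Sum>j\<in>nbh P (nd \<omega> s t). (norm (err_c P (\<nu> \<omega>) (nd \<omega>) s t j))\<^sup>2)" for \<omega>
      unfolding C_def err_c_def
      by (rule norm_grad_diff_square_le[OF problem supported_blocks_xinhat supported_blocks_xin])
    then show ?thesis
      unfolding integral_mult_right_zero[symmetric]
      by (intro integral_mono sq[OF CM] integrable_mult_right sum_bm c)
  qed
  also have "(\<integral>\<omega>. (norm (Y \<omega>))\<^sup>2 \<partial>M) \<le>
      2 * (?L2 * (\<integral>\<omega>. (\<Sum>j\<in>nbh P (nd \<omega> s t). (norm (err_a P (\<nu> \<omega>) (nd \<omega>) s j))\<^sup>2) \<partial>M))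
      + 2 * (\<integral>\<omega>. (norm (err_b P (\<nu> \<omega>) (nd \<omega>) s (nd \<omega> s t)))\<^sup>2 \<partial>M)"
  proof -
    \<comment> \<open>The past of \<open>(s, 0)\<close> does not contain the draw
      \<open>(s, t)\<close>, so the families \<open>A\<close> and \<open>B\<close> qualify for
      averaging over it.\<close>
    have past: "oth.past_measurable (Inl (s, t)) s 0" by (rule past_measurable_others) simp
    have cenM: "bounded_measurable M (\<lambda>\<omega>. cen A (nd \<omega> s t) \<omega>)"
        "bounded_measurable M (\<lambda>\<omega>. cen B (nd \<omega> s t) \<omega>)"
      by (rule sel, rule cen, rule AM BM)+
    \<comment> \<open>The only place where a factor 2 enters.\<close>
    have "(norm (x + y))\<^sup>2 \<le> 2 * (norm x)\<^sup>2 + 2 * (norm y)\<^sup>2" for x y :: "real^'p"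
    proof -
      have "0 \<le> (x - y) \<bullet> (x - y)" by simp
      then show ?thesis
        by (simp add: power2_norm_eq_inner inner_add_left inner_add_right inner_diff_left
            inner_diff_right inner_commute)
    qed
    then have "(\<integral>\<omega>. (norm (Y \<omega>))\<^sup>2 \<partial>M) \<le>
        (\<integral>\<omega>. 2 * (norm (cen A (nd \<omega> s t) \<omega>))\<^sup>2 + 2 * (norm (cen B (nd \<omega> s t) \<omega>))\<^sup>2 \<partial>M)"
      using sq[OF YM] sq[OF cenM(1)] sq[OF cenM(2)] by (intro integral_mono) (auto simp: Y_def)
    also have "\<dots> = 2 * (\<integral>\<omega>. (norm (cen A (nd \<omega> s t) \<omega>))\<^sup>2 \<partial>M) + 2 * (\<integral>\<omega>. (norm (cen B (nd \<omega> s t) \<omega>))\<^sup>2 \<partial>M)"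
      using sq[OF cenM(1)] sq[OF cenM(2)] by simp
    also have "(\<integral>\<omega>. (norm (cen A (nd \<omega> s t) \<omega>))\<^sup>2 \<partial>M) \<le> (\<integral>\<omega>. (norm (A (nd \<omega> s t) \<omega>))\<^sup>2 \<partial>M)"
      unfolding cen_def
      by (rule expectation_centered_le[OF t]) (unfold A_def, rule oth.grad_diff_outer_bounded_measurable[OF past])
    also have "(\<integral>\<omega>. (norm (cen B (nd \<omega> s t) \<omega>))\<^sup>2 \<partial>M) \<le> (\<integral>\<omega>. (norm (B (nd \<omega> s t) \<omega>))\<^sup>2 \<partial>M)"
      unfolding cen_def
      by (rule expectation_centered_le[OF t]) (unfold B_def, rule oth.err_b_bounded_measurable[OF past])
    also have "(\<integral>\<omega>. (norm (A (nd \<omega> s t) \<omega>))\<^sup>2 \<partial>M) \<le>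
        ?L2 * (\<integral>\<omega>. (\<Sum>j\<in>nbh P (nd \<omega> s t). (norm (err_a P (\<nu> \<omega>) (nd \<omega>) s j))\<^sup>2) \<partial>M)"
    proof -
      have "(norm (A (nd \<omega> s t) \<omega>))\<^sup>2 \<le>
          ?L2 * (\<Sum>j\<in>nbh P (nd \<omega> s t). (norm (err_a P (\<nu> \<omega>) (nd \<omega>) s j))\<^sup>2)" for \<omega>
        unfolding A_def err_a_def
        by (rule norm_grad_diff_square_le[OF problem supported_blocks_xthat supported_blocks_xtil])
      then show ?thesis
        unfolding integral_mult_right_zero[symmetric]
        by (intro integral_mono sq[OF sel[OF AM]] integrable_mult_right sum_bm
            err_a_bounded_measurable past_measurable_M)
    qed
    finally show ?thesis by (simp add: B_def)
  qed
  finally show ?le by (simp add: D_def)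
qed

end

section \<open>Recursion and error bound combined\<close>

theorem lemma1:
  fixes P :: "('n::finite, 'p::finite) isgd"
    and M :: "'w measure"
    and \<nu> :: "'w \<Rightarrow> ('n, 'p) dither \<Rightarrow> real"
    and nd :: "'w \<Rightarrow> nat \<Rightarrow> nat \<Rightarrow> 'n"
  assumes problem: "isgd_problem P"
    and randomness: "isgd_randomness P M \<nu> nd"
    and intervals: "AE \<omega> in M. values_in_intervals P (\<nu> \<omega>) (nd \<omega>)"
  shows
    "(\<forall>\<omega> \<in> space M.
        conc (xtil P (\<nu> \<omega>) (nd \<omega>) 0) = 0 \<and>
        (\<forall>s. conc (xin P (\<nu> \<omega>) (nd \<omega>) s 0) = conc (xtil P (\<nu> \<omega>) (nd \<omega>) s) \<and>
             conc (xtil P (\<nu> \<omega>) (nd \<omega>) (Suc s)) =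
               (1 / real (inner_len P)) *\<^sub>R
                 (\<Sum>t = 1..inner_len P. conc (xin P (\<nu> \<omega>) (nd \<omega>) s t)) \<and>
             (\<forall>t < inner_len P.
                conc (xin P (\<nu> \<omega>) (nd \<omega>) s (Suc t)) =
                  prox (stepsize P) (regul P)
                    (conc (xin P (\<nu> \<omega>) (nd \<omega>) s t)
                       - stepsize P *\<^sub>R svrg_dir P (\<nu> \<omega>) (nd \<omega>) s t)))) \<and>
     (\<forall>s. \<forall>t < inner_len P.
        integrable M (\<lambda>\<omega>. (norm (svrg_err P (\<nu> \<omega>) (nd \<omega>) s t))\<^sup>2) \<and>
        (\<integral>\<omega>. (norm (svrg_err P (\<nu> \<omega>) (nd \<omega>) s t))\<^sup>2 \<partial>M) \<le>
            2 * (Max (range (lipc P)))\<^sup>2 *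
              (\<integral>\<omega>. (\<Sum>j \<in> nbh P (nd \<omega> s t).
                    (norm (err_c P (\<nu> \<omega>) (nd \<omega>) s t j))\<^sup>2) \<partial>M)
          + 2 * (Max (range (lipc P)))\<^sup>2 *
              (\<integral>\<omega>. (\<Sum>j \<in> nbh P (nd \<omega> s t).
                    (norm (err_a P (\<nu> \<omega>) (nd \<omega>) s j))\<^sup>2) \<partial>M)
          + (\<integral>\<omega>. (norm (err_d P (\<nu> \<omega>) (nd \<omega>) s t))\<^sup>2 \<partial>M)
          + 2 * (\<integral>\<omega>. (norm (err_b P (\<nu> \<omega>) (nd \<omega>) s (nd \<omega> s t)))\<^sup>2 \<partial>M)
          + 2 / (real CARD('n))\<^sup>2 *
              (\<Sum>i\<in>UNIV. \<integral>\<omega>. (norm (err_b P (\<nu> \<omega>) (nd \<omega>) s i))\<^sup>2 \<partial>M))"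
proof -
  interpret prob_space M using randomness by (simp add: isgd_randomness_def)
  interpret isgd_prob M P \<nu> nd
    by unfold_locales (rule problem randomness)+
  have sym: "sym (edges P)"
    and blockwise: "\<And>x. gprox P x = conc (\<lambda>i. prox_block P i (selmat (own_coords P i) *v x))"
    using problem by (simp_all add: isgd_problem_def)
  show ?thesis
  proof (intro conjI ballI allI impI)
    fix \<omega>
    show "conc (xtil P (\<nu> \<omega>) (nd \<omega>) 0) = 0" by (simp add: xtil_0 conc_def)
  next
    fix \<omega> s
    show "conc (xin P (\<nu> \<omega>) (nd \<omega>) s 0) = conc (xtil P (\<nu> \<omega>) (nd \<omega>) s)" by (simp add: xin_0)
  next
    fix \<omega> s
    show "conc (xtil P (\<nu> \<omega>) (nd \<omega>) (Suc s)) =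
        (1 / real (inner_len P)) *\<^sub>R (\<Sum>t = 1..inner_len P. conc (xin P (\<nu> \<omega>) (nd \<omega>) s t))"
      by (rule conc_xtil_Suc)
  next
    fix \<omega> s t
    show "conc (xin P (\<nu> \<omega>) (nd \<omega>) s (Suc t)) = prox (stepsize P) (regul P)
        (conc (xin P (\<nu> \<omega>) (nd \<omega>) s t) - stepsize P *\<^sub>R svrg_dir P (\<nu> \<omega>) (nd \<omega>) s t)"
      using conc_xin_Suc[OF sym blockwise] by (simp add: gprox_def)
  next
    fix s t
    assume t: "t < inner_len P"
    show "integrable M (\<lambda>\<omega>. (norm (svrg_err P (\<nu> \<omega>) (nd \<omega>) s t))\<^sup>2)"
      by (rule expectation_svrg_err_le(1)[OF t])
    \<comment> \<open>The estimate obtained has coefficient 1 on the \<open>err_c\<close> term and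
      no averaged \<open>err_b\<close> term; the stated bound exceeds it by these two nonnegative
      amounts.\<close>
    have "0 \<le> (Max (range (lipc P)))\<^sup>2 *
        (\<integral>\<omega>. (\<Sum>j \<in> nbh P (nd \<omega> s t). (norm (err_c P (\<nu> \<omega>) (nd \<omega>) s t j))\<^sup>2) \<partial>M)"
      by (intro mult_nonneg_nonneg Bochner_Integration.integral_nonneg sum_nonneg) auto
    moreover have "0 \<le> 2 / (real CARD('n))\<^sup>2 *
        (\<Sum>i\<in>UNIV. \<integral>\<omega>. (norm (err_b P (\<nu> \<omega>) (nd \<omega>) s i))\<^sup>2 \<partial>M)"
      by (intro mult_nonneg_nonneg Bochner_Integration.integral_nonneg sum_nonneg) auto
    ultimately show "(\<integral>\<omega>. (norm (svrg_err P (\<nu> \<omega>) (nd \<omega>) s t))\<^sup>2 \<partial>M) \<le>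
            2 * (Max (range (lipc P)))\<^sup>2 *
              (\<integral>\<omega>. (\<Sum>j \<in> nbh P (nd \<omega> s t).
                    (norm (err_c P (\<nu> \<omega>) (nd \<omega>) s t j))\<^sup>2) \<partial>M)
          + 2 * (Max (range (lipc P)))\<^sup>2 *
              (\<integral>\<omega>. (\<Sum>j \<in> nbh P (nd \<omega> s t).
                    (norm (err_a P (\<nu> \<omega>) (nd \<omega>) s j))\<^sup>2) \<partial>M)
          + (\<integral>\<omega>. (norm (err_d P (\<nu> \<omega>) (nd \<omega>) s t))\<^sup>2 \<partial>M)
          + 2 * (\<integral>\<omega>. (norm (err_b P (\<nu> \<omega>) (nd \<omega>) s (nd \<omega> s t)))\<^sup>2 \<partial>M)
          + 2 / (real CARD('n))\<^sup>2 *
              (\<Sum>i\<in>UNIV. \<integral>\<omega>. (norm (err_b P (\<nu> \<omega>) (nd \<omega>) s i))\<^sup>2 \<partial>M)"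
      using expectation_svrg_err_le(2)[OF t, of s] by linarith
  qed
qed

end
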